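(* Let $f,g:\mathbb{R}^n\to\mathbb{R}$ be proper, lower semicontinuous, convex and $L$-Lipschitz, with $\arg\min(f+g)\neq\emptyset$, and let $\Lambda$ be a Lipschitz constant of $f+g$ (for instance $\Lambda=2L$). Let $(t_k)_{k\ge1}$, $(\delta_k)_{k\ge1}$, $(\alpha_k)_{k\ge1}$ be real sequences and $(N_k)_{k\ge1}$ a sequence of positive integers such that: (1) $t_k>0$ and $t_k$ converges to $0$ at rate $\mathcal{O}(1/k)$; (2) $\delta_k>0$, $\alpha_k\in(0,1)$, $\sum_{k=1}^\infty\delta_k<\infty$ and $\sum_{k=1}^\infty\alpha_k<\infty$; (3) with $J_k=\exp\left(\frac{2}{\delta_k}\Lambda^2t_k\right)$ and $M_k=nt_k\delta_k+\left(2\sqrt{nt_k\delta_k}+3\Lambda t_k\right)^2$, one has $N_k\ge\frac{8J_k}{\alpha_k}$ for all $k$ and $\sum_{k=1}^\infty\left(\sqrt{\frac{8J_kM_k}{\alpha_kN_k}}+\sqrt{n\,t_k\,\delta_k}\right)<\infty$. Let $x_1\in\mathbb{R}^n$ and consider the random iteration $$x_{k+1}=\widehat{\operatorname{prox}}^{\delta_k}_{t_k(f+g)}(x_k),\qquad k\ge1,$$ where the estimator at iteration $k$ uses $N_k$ samples. Then $x_k$ converges almost surely to a minimizer of $f+g$.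
   Context: For $F:\mathbb{R}^n\to\mathbb{R}$, $t,\delta>0$ and $x\in\mathbb{R}^n$, the sampled Hamilton-Jacobi proximal estimator with $N$ samples is $$\widehat{\operatorname{prox}}^{\delta}_{tF}(x)=\frac{\sum_{i=1}^N Z_i\exp(-F(Z_i)/\delta)}{\sum_{i=1}^N \exp(-F(Z_i)/\delta)},\qquad Z_1,\dots,Z_N\text{ i.i.d. }\sim\mathcal{N}(x,\delta tI_n).$$ In the iteration, fresh samples are drawn at every evaluation: conditionally on all samples drawn earlier, the samples used are i.i.d. with the stated Gaussian law centered at the current (random) argument.
   Formalization: The formal theorem additionally assumes that the series of t_k diverges (as for t_k of exact order 1/k); with only t_k = O(1/k) the claim fails, e.g. for f=|x|, g=0, t_k=δ_k=1/k², α_k=4^{-k}, N_k huge and x_1 far from 0. *)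

theory Defs
  imports "HOL-Probability.Probability" "HOL-Library.Landau_Symbols"
begin

definition lower_semicontinuous :: "('a::topological_space \<Rightarrow> real) \<Rightarrow> bool" where
  "lower_semicontinuous F \<longleftrightarrow> (\<forall>x. ereal (F x) \<le> Liminf (at x) (\<lambda>y. ereal (F y)))"

text \<open>The normal law with mean \<open>\<mu>\<close> and covariance matrix \<open>v I\<close>; the second parameter is
  the variance of each coordinate (not the standard deviation), and only \<open>v > 0\<close> is meaningful.\<close>

definition gaussian :: "real ^ 'n \<Rightarrow> real \<Rightarrow> (real ^ 'n) measure" where
  "gaussian \<mu> v =
     density lborel (\<lambda>z. ennreal (exp (- (norm (z - \<mu>))\<^sup>2 / (2 * v)) / sqrt (2 * pi * v) ^ CARD('n)))"

text \<open>The estimator as a function of its samples \<open>z 1, \<dots>, z N\<close>. The proximal parameter \<open>t\<close> does not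
  occur here: it enters only through the covariance \<open>\<delta> t I\<close> of the law of the samples.\<close>

definition hj_prox_estimate ::
    "('a::real_vector \<Rightarrow> real) \<Rightarrow> real \<Rightarrow> nat \<Rightarrow> (nat \<Rightarrow> 'a) \<Rightarrow> 'a" where
  "hj_prox_estimate F \<delta> N z =
     (\<Sum>i=1..N. exp (- F (z i) / \<delta>) *\<^sub>R z i) /\<^sub>R (\<Sum>i=1..N. exp (- F (z i) / \<delta>))"

text \<open>\<open>Z j i\<close> is the \<open>i\<close>-th sample of iteration \<open>j\<close>; iterations are numbered from 1. The following is
  the sigma-algebra generated by all samples drawn before iteration \<open>k\<close>, trivial for \<open>k = 1\<close>.\<close>

definition sample_history ::
    "'w measure \<Rightarrow> (nat \<Rightarrow> nat) \<Rightarrow> (nat \<Rightarrow> nat \<Rightarrow> 'w \<Rightarrow> 'b::topological_space) \<Rightarrow> nat \<Rightarrow> 'w measure" where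
  "sample_history M N Z k =
     sigma (space M) (\<Union>j\<in>{1..<k}. \<Union>i\<in>{1..N j}. {Z j i -` A \<inter> space M |A. A \<in> sets borel})"

text \<open>For finite \<open>I\<close>: conditionally on the sub-sigma-algebra \<open>G\<close>, the variables \<open>Y i\<close> with \<open>i \<in> I\<close>
  are i.i.d. with the random law \<open>K\<close>. It is enough to prescribe the conditional probabilities of
  measurable rectangles, since these determine a law on the product space.\<close>

definition cond_iid ::
    "'w measure \<Rightarrow> 'w measure \<Rightarrow> 'i set \<Rightarrow> ('i \<Rightarrow> 'w \<Rightarrow> 'b::topological_space) \<Rightarrow> ('w \<Rightarrow> 'b measure) \<Rightarrow> bool" where
  "cond_iid M G I Y K \<longleftrightarrow>
     (\<forall>A. (\<forall>i\<in>I. A i \<in> sets borel) \<longrightarrow>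
        (AE \<omega> in M. real_cond_exp M G (indicator {\<omega>\<in>space M. \<forall>i\<in>I. Y i \<omega> \<in> A i}) \<omega>
                     = (\<Prod>i\<in>I. measure (K \<omega>) (A i))))"

end

theory Submission
  imports Defs
begin

text \<open>Put \<open>F = f + g\<close>. If \<open>\<Sum> |X (k + 1) - prox (X k)|\<close> is finite, the iteration is an inexact proximal point
  method with summable errors and non-summable step sizes: the distances to every minimizer converge by
  quasi-Fejer monotonicity, \<open>F\<close> comes close to its minimum along a subsequence, and a cluster point of that
  subsequence is the limit.

  For the errors let \<open>p = prox x\<close>, \<open>w = exp (- F / \<delta>)\<close> and let \<open>m\<close> be the Gaussian mean of \<open>w\<close>. Writing the
  estimator minus \<open>p\<close> as the weighted mean of \<open>Z i - p\<close>, one splits according to whether the empirical mean of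
  the weights is below \<open>m / 2\<close>. This has conditional probability at most a constant times
  \<open>E w\<^sup>2 / (N m\<^sup>2)\<close> by Chebyshev's inequality, and \<open>E w\<^sup>2 \<le> 5\<^sup>n J m\<^sup>2\<close>, so it is \<open>O(\<alpha>)\<close>. Otherwise Jensen's inequality
  bounds the squared error by twice the empirical mean of \<open>w |Z - p|\<^sup>2 / m\<close>, whose expectation is \<open>O(t \<delta>)\<close>
  because the density proportional to \<open>w\<close> times the Gaussian one is strongly log-concave with mode \<open>p\<close>.
  Hence \<open>E min 1 |error| = O(\<alpha> + sqrt (t \<delta>))\<close>, which is summable. The constants depend on the dimension, which
  is harmless and avoids treating bias and sampling error separately.\<close>

section \<open>The proximal point method with summable errors\<close>

text \<open>The minimizer of \<open>F + |\<cdot> - x|\<^sup>2 / (2 t)\<close>, encoded by its optimality condition: \<open>(x - p) / t\<close> is a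
  subgradient of \<open>F\<close> at \<open>p\<close>. The choice is meaningful for convex Lipschitz \<open>F\<close> and \<open>t > 0\<close>.\<close>

definition prox :: "('a::real_inner \<Rightarrow> real) \<Rightarrow> real \<Rightarrow> 'a \<Rightarrow> 'a" where
  "prox F t x = (SOME p. \<forall>z. F p + (x - p) \<bullet> (z - p) / t \<le> F z)"

text \<open>Outside the ball of radius \<open>R\<close> the quadratic penalty in \<open>U\<close>
  outweighs any decrease of the Lipschitz function \<open>F\<close>, so compactness of the ball
  gives a global minimizer of \<open>U\<close>. Comparing \<open>U p\<close> with \<open>U\<close>
  at points near \<open>p\<close> on the segment to \<open>z\<close> turns minimality into the
  subgradient inequality.\<close>

lemma prox_exists:
  fixes F :: "'a::euclidean_space \<Rightarrow> real"
  assumes convex: "convex_on UNIV F" and lip: "\<Lambda>-lipschitz_on UNIV F" and t: "t > 0"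
  shows "\<exists>p. \<forall>z. F p + (x - p) \<bullet> (z - p) / t \<le> F z"
proof -
  define U where "U z = F z + (norm (z - x))\<^sup>2 / (2 * t)" for z
  \<comment> \<open>At distance r = \<open>R\<close> the penalty r^2 / (2 t) catches up with
    \<Lambda> r, the largest possible decrease of \<open>F\<close>.\<close>
  define R where "R = 2 * t * \<Lambda>"
  have L0: "\<Lambda> \<ge> 0"
    using lip by (rule lipschitz_on_nonneg)
  have R0: "R \<ge> 0"
    using L0 t by (simp add: R_def)
  have contF: "continuous_on UNIV F"
    using lip by (rule lipschitz_on_continuous_on)
  have "continuous_on (cball x R) U"
    unfolding U_def by (intro continuous_intros continuous_on_subset[OF contF]) (use t in auto)
  moreover have "cball x R \<noteq> {}"
    using R0 by simp
  ultimately obtain p where p: "p \<in> cball x R" "\<And>z. z \<in> cball x R \<Longrightarrow> U p \<le> U z"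
    using continuous_attains_inf[OF compact_cball] by metis
  have min: "U p \<le> U z" for z
  proof (cases "z \<in> cball x R")
    case False
    then have far: "norm (z - x) > R"
      by (simp add: dist_norm norm_minus_commute)
    have "F x - F z \<le> \<Lambda> * norm (z - x)"
      using lipschitz_onD[OF lip, of x z] by (simp add: dist_norm norm_minus_commute)
    also have "\<dots> \<le> norm (z - x) * norm (z - x) / (2 * t)"
      using mult_right_mono[OF less_imp_le[OF far] norm_ge_zero[of "z - x"]] t
      by (simp add: R_def field_simps)
    finally have "U x \<le> U z"
      by (simp add: U_def power2_eq_square)
    moreover have "U p \<le> U x"
      using p(2)[of x] R0 by simp
    ultimately show ?thesis by simp
  qed (rule p(2))
  have "F p + (x - p) \<bullet> (z - p) / t \<le> F z" for z
  proof -
    \<comment> \<open>\<open>c\<close> is the slack to be shown nonnegative and \<open>d\<close> a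
      second-order coefficient: bounding \<open>F y\<close> by convexity in
      \<open>U p \<le> U y\<close> and dividing by \<epsilon> leaves
      \<open>0 \<le> c + \<epsilon> * d\<close>.\<close>
    define c where "c = F z - F p - (x - p) \<bullet> (z - p) / t"
    define d where "d = (norm (z - p))\<^sup>2 / (2 * t)"
    have *: "0 \<le> c + \<epsilon> * d" if \<epsilon>: "\<epsilon> > 0" "\<epsilon> < 1" for \<epsilon>
    proof -
      define i where "i = (p - x) \<bullet> (z - p)"
      have i_eq: "i = - ((x - p) \<bullet> (z - p))"
        by (simp add: i_def inner_diff_left)
      define y where "y = (1 - \<epsilon>) *\<^sub>R p + \<epsilon> *\<^sub>R z"
      have "F y \<le> (1 - \<epsilon>) * F p + \<epsilon> * F z"
        unfolding y_def using convex_onD[OF convex, of \<epsilon> p z] \<epsilon> by simp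
      moreover have "U p \<le> U y"
        by (rule min)
      moreover have "y - x = (p - x) + \<epsilon> *\<^sub>R (z - p)"
        by (simp add: y_def algebra_simps)
      then have "(norm (y - x))\<^sup>2 = (norm (p - x))\<^sup>2 + 2 * \<epsilon> * i + \<epsilon>\<^sup>2 * (norm (z - p))\<^sup>2"
        unfolding i_def by (simp only: power2_norm_eq_inner inner_add_left inner_add_right inner_scaleR_left
            inner_scaleR_right inner_commute[of "z - p" "p - x"]) (simp add: power2_eq_square algebra_simps)
      ultimately have "0 \<le> \<epsilon> * (F z - F p) + (2 * \<epsilon> * i + \<epsilon>\<^sup>2 * (norm (z - p))\<^sup>2) / (2 * t)"
        by (simp add: U_def algebra_simps add_divide_distrib)
      also have "\<dots> = \<epsilon> * (c + \<epsilon> * d)"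
        unfolding c_def d_def using t i_eq by (simp add: field_simps power2_eq_square)
      finally show ?thesis
        using \<epsilon> by (simp add: zero_le_mult_iff)
    qed
    have "0 \<le> c"
    proof (rule tendsto_lowerbound)
      have "((\<lambda>\<epsilon>. c + \<epsilon> * d) \<longlongrightarrow> c + 0 * d) (at_right 0)"
        by (intro tendsto_intros)
      then show "((\<lambda>\<epsilon>. c + \<epsilon> * d) \<longlongrightarrow> c) (at_right 0)"
        by simp
      show "\<forall>\<^sub>F \<epsilon> in at_right 0. 0 \<le> c + \<epsilon> * d"
        using eventually_at_right_real[OF zero_less_one] by eventually_elim (use * in auto)
    qed simp
    then show ?thesis
      by (simp add: c_def)
  qed
  then show ?thesis by blast
qed

lemma prox_subgradient:
  fixes F :: "'a::euclidean_space \<Rightarrow> real"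
  assumes "convex_on UNIV F" "\<Lambda>-lipschitz_on UNIV F" "t > 0"
  shows "F (prox F t x) + (x - prox F t x) \<bullet> (z - prox F t x) / t \<le> F z"
  using someI_ex[OF prox_exists[OF assms]] unfolding prox_def by blast

text \<open>The subgradient inequality tested at \<open>z = x\<close> bounds |x - p|^2 / t by F x -
  F p, which is at most \<Lambda> |x - p|.\<close>

lemma norm_diff_prox_le:
  fixes F :: "'a::euclidean_space \<Rightarrow> real"
  assumes "convex_on UNIV F" and lip: "\<Lambda>-lipschitz_on UNIV F" and t: "t > 0"
  shows "norm (x - prox F t x) \<le> t * \<Lambda>"
proof -
  define p where "p = prox F t x"
  define s where "s = x - p"
  have "F p + s \<bullet> s / t \<le> F x"
    using prox_subgradient[OF assms, of x x] by (simp add: p_def s_def)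
  moreover have "F x - F p \<le> \<Lambda> * norm s"
    using lipschitz_onD[OF lip, of x p] by (simp add: dist_norm s_def)
  ultimately have "s \<bullet> s / t \<le> \<Lambda> * norm s"
    by linarith
  then have "norm s * norm s \<le> (t * \<Lambda>) * norm s"
    using t by (simp add: field_simps dot_square_norm power2_eq_square)
  then have "norm s \<le> t * \<Lambda>"
    using t lipschitz_on_nonneg[OF lip] by (cases "s = 0") auto
  then show ?thesis
    by (simp add: p_def s_def)
qed

text \<open>The proximal map is nonexpansive: the two subgradient inequalities, each tested at the
  other proximal point, add up to |p - q|^2 \<le> (x - y) \<bullet> (p - q). Continuity later yields
  measurability of the exact proximal points of the random iterates.\<close>

lemma continuous_on_prox:
  fixes F :: "'a::euclidean_space \<Rightarrow> real"
  assumes "convex_on UNIV F" "\<Lambda>-lipschitz_on UNIV F" and t: "t > 0"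
  shows "continuous_on UNIV (prox F t)"
proof -
  have "1-lipschitz_on UNIV (prox F t)"
  proof (rule lipschitz_onI)
    fix x y :: 'a
    define p q where "p = prox F t x" and "q = prox F t y"
    have "F p + (x - p) \<bullet> (q - p) / t \<le> F q" "F q + (y - q) \<bullet> (p - q) / t \<le> F p"
      unfolding p_def q_def by (rule prox_subgradient[OF assms])+
    then have "((x - p) \<bullet> (q - p) + (y - q) \<bullet> (p - q)) / t \<le> 0"
      by (simp add: add_divide_distrib)
    then have "(x - p) \<bullet> (q - p) + (y - q) \<bullet> (p - q) \<le> 0"
      using t by (simp add: divide_le_0_iff)
    then have "(p - q) \<bullet> (p - q) \<le> (x - y) \<bullet> (p - q)"
      by (simp add: inner_diff_left inner_diff_right inner_commute)
    also have "\<dots> \<le> norm (x - y) * norm (p - q)"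
      by (rule norm_cauchy_schwarz)
    finally have "norm (p - q) * norm (p - q) \<le> norm (x - y) * norm (p - q)"
      by (simp add: dot_square_norm power2_eq_square)
    then have "norm (p - q) \<le> norm (x - y)"
      by (cases "p = q") auto
    then show "dist (prox F t x) (prox F t y) \<le> 1 * dist x y"
      by (simp add: p_def q_def dist_norm)
  qed simp
  then show ?thesis
    by (rule lipschitz_on_continuous_on)
qed

section \<open>Quasi-Fejer monotonicity and convergence of the iterates\<close>

text \<open>Subtracting the partial sums of \<open>e\<close> makes the sequence decreasing, and
  summability keeps it bounded below.\<close>

lemma convergent_if_increments_summable:
  fixes b e :: "nat \<Rightarrow> real"
  assumes step: "\<And>k. b (Suc k) \<le> b k + e k" and nonneg: "\<And>k. 0 \<le> b k" "\<And>k. 0 \<le> e k"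
    and e: "summable e"
  shows "convergent b"
proof -
  define c where "c k = b k - (\<Sum>i<k. e i)" for k
  have "decseq c"
    by (rule decseq_SucI) (use step in \<open>simp add: c_def algebra_simps\<close>)
  moreover have "- suminf e \<le> c k" for k
    using nonneg(1)[of k] nonneg(2) sum_le_suminf[OF e, of "{..<k}"] by (simp add: c_def)
  ultimately obtain l where "c \<longlonglongrightarrow> l"
    by (metis decseq_convergent)
  then have "(\<lambda>k. c k + (\<Sum>i<k. e i)) \<longlonglongrightarrow> l + suminf e"
    by (intro tendsto_add summable_LIMSEQ e)
  then show ?thesis
    by (auto simp: c_def convergent_def)
qed

text \<open>Summable errors make the distances to every minimizer converge; non-summable step sizes
  make the gap of \<open>F\<close> at \<open>p k\<close> small infinitely often. A cluster point
  along such indices is a minimizer, so the distances to it converge as well, and their limit can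
  only be 0.\<close>

lemma inexact_proximal_point_converges:
  fixes F :: "'a::euclidean_space \<Rightarrow> real" and x p :: "nat \<Rightarrow> 'a"
  assumes lip: "\<Lambda>-lipschitz_on UNIV F"
    and prox: "\<And>k z. F (p k) + (x k - p k) \<bullet> (z - p k) / t k \<le> F z"
    and t: "\<And>k. t k > 0" "\<not> summable t"
    and err: "summable (\<lambda>k. norm (x (Suc k) - p k))"
    and z0: "\<And>y. F z0 \<le> F y"
  shows "\<exists>z. (\<forall>y. F z \<le> F y) \<and> x \<longlonglongrightarrow> z"
proof -
  define e where "e k = norm (x (Suc k) - p k)" for k
  have e0: "e k \<ge> 0" for k
    by (simp add: e_def)
  have e_sum: "summable e"
    using err by (simp add: e_def[abs_def])
  have e_lim: "e \<longlonglongrightarrow> 0"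
    by (rule summable_LIMSEQ_zero[OF e_sum])
  \<comment> \<open>Expand |x - z|^2 around \<open>p k\<close>: the subgradient inequality controls
    the cross term, and |x - p|^2 is dropped.\<close>
  have key: "2 * t k * (F (p k) - F z) + (norm (p k - z))\<^sup>2 \<le> (norm (x k - z))\<^sup>2" for k z
  proof -
    have "t k * (F (p k) - F z) \<le> - ((x k - p k) \<bullet> (z - p k))"
      using prox[of k z] t(1)[of k] by (simp add: field_simps)
    moreover have "(norm (x k - z))\<^sup>2 = (norm (x k - p k))\<^sup>2 + (norm (p k - z))\<^sup>2 - 2 * ((x k - p k) \<bullet> (z - p k))"
      by (simp add: power2_norm_eq_inner inner_diff_left inner_diff_right inner_commute)
    moreover have "0 \<le> (norm (x k - p k))\<^sup>2"
      by simp
    ultimately show ?thesis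
      by linarith
  qed
  have p_le: "norm (p k - z) \<le> norm (x k - z)" if z: "\<And>y. F z \<le> F y" for k z
  proof (rule power2_le_imp_le)
    have "0 \<le> 2 * t k * (F (p k) - F z)"
      using t(1)[of k] z[of "p k"] by simp
    then show "(norm (p k - z))\<^sup>2 \<le> (norm (x k - z))\<^sup>2"
      using key[of k z] by linarith
  qed simp
  have step: "norm (x (Suc k) - z) \<le> norm (p k - z) + e k" for k z
    using norm_triangle_ineq[of "x (Suc k) - p k" "p k - z"] by (simp add: e_def)
  have dist_conv: "convergent (\<lambda>k. norm (x k - z))" if z: "\<And>y. F z \<le> F y" for z
  proof (rule convergent_if_increments_summable[OF _ _ _ e_sum])
    show "norm (x (Suc k) - z) \<le> norm (x k - z) + e k" for k
      using step[of k z] p_le[OF z, of k] by linarith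
  qed (use e0 in auto)
  obtain B where B: "\<And>k. norm (x k - z0) \<le> B"
    using convergent_imp_Bseq[OF dist_conv[OF z0]] by (auto simp: Bseq_def)
  have B0: "B \<ge> 0"
    using B[of 0] norm_ge_zero order_trans by blast
  have gap_sum: "summable (\<lambda>k. 2 * t k * (F (p k) - F z0))"
  proof (rule summableI_nonneg_bounded)
    define b where "b k = (norm (x k - z0))\<^sup>2" for k
    define E where "E = suminf e"
    have E: "e k \<le> E" for k
      using sum_le_suminf[OF e_sum, of "{k}"] e0 by (simp add: E_def)
    have E0: "E \<ge> 0"
      using E[of 0] e0[of 0] by linarith
    \<comment> \<open>The squared distances \<open>b\<close> telescope. Passing from
      \<open>p k\<close> to the next iterate costs at most \<open>(2 * B + E) * e k\<close>, because
      \<open>p k\<close> is no farther from \<open>z0\<close> than \<open>x k\<close> is.\<close>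
    have "2 * t k * (F (p k) - F z0) \<le> b k - b (Suc k) + (2 * B + E) * e k" for k
    proof -
      have "b (Suc k) \<le> (norm (p k - z0) + e k)\<^sup>2"
        unfolding b_def using step[of k z0] by (intro power_mono) auto
      also have "\<dots> = (norm (p k - z0))\<^sup>2 + (2 * norm (p k - z0) + e k) * e k"
        by (simp add: power2_eq_square algebra_simps)
      also have "\<dots> \<le> (norm (p k - z0))\<^sup>2 + (2 * B + E) * e k"
        using p_le[OF z0, of k] B[of k] E[of k] e0[of k] by (intro add_left_mono mult_right_mono) auto
      finally show ?thesis
        using key[of k z0] by (simp add: b_def)
    qed
    then have "(\<Sum>k<n. 2 * t k * (F (p k) - F z0)) \<le> (\<Sum>k<n. b k - b (Suc k) + (2 * B + E) * e k)" for n
      by (intro sum_mono)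
    also have "(\<Sum>k<n. b k - b (Suc k) + (2 * B + E) * e k) = b 0 - b n + (2 * B + E) * (\<Sum>k<n. e k)" for n
      by (simp only: sum.distrib sum_lessThan_telescope' sum_distrib_left)
    also have "b 0 - b n + (2 * B + E) * (\<Sum>k<n. e k) \<le> b 0 + (2 * B + E) * suminf e" for n
      using sum_le_suminf[OF e_sum, of "{..<n}"] e0 B0 E0
      by (intro add_mono mult_left_mono) (auto simp: b_def)
    finally show "(\<Sum>k<n. 2 * t k * (F (p k) - F z0)) \<le> b 0 + (2 * B + E) * suminf e" for n .
    show "0 \<le> 2 * t k * (F (p k) - F z0)" for k
      using t(1)[of k] z0[of "p k"] by simp
  qed
  \<comment> \<open>A gap of at least \<epsilon> from index \<open>n\<close> on would bound 2
    \<epsilon> t by the summable sequence of \<open>gap_sum\<close>.\<close>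
  have frequently: "\<exists>k\<ge>n. F (p k) - F z0 < \<epsilon>" if \<epsilon>: "\<epsilon> > 0" for n \<epsilon>
  proof (rule ccontr)
    assume "\<not> ?thesis"
    then have big: "\<epsilon> \<le> F (p k) - F z0" if "k \<ge> n" for k
      using that by (meson not_le)
    have "summable (\<lambda>k. 2 * \<epsilon> * t k)"
    proof (rule summable_comparison_test'[OF gap_sum])
      show "norm (2 * \<epsilon> * t k) \<le> 2 * t k * (F (p k) - F z0)" if "k \<ge> n" for k
        using mult_left_mono[OF big[OF that], of "2 * t k"] t(1)[of k] \<epsilon> by (simp add: mult_ac)
    qed
    then show False
      using t(2) \<epsilon> by (simp add: summable_cmult_iff)
  qed
  have "\<exists>k. \<forall>n. k n \<ge> n \<and> F (p (k n)) - F z0 < inverse (real (Suc n))"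
    by (intro choice allI) (use frequently in force)
  then obtain k where k: "\<And>n. k n \<ge> n" "\<And>n. F (p (k n)) - F z0 < inverse (real (Suc n))"
    by blast
  have k_lim: "filterlim k sequentially sequentially"
    by (rule filterlim_at_top_mono[OF filterlim_ident]) (use k in auto)
  \<comment> \<open>The successor index matters: \<open>x (Suc k)\<close> is within
    \<open>e k\<close> of \<open>p k\<close>, so both subsequences share the limit \<open>l\<close>,
    and the vanishing gap at \<open>p\<close> passes to \<open>F l\<close> by continuity.\<close>
  have "bounded (range (\<lambda>n. x (Suc (k n))))"
    using B by (auto simp: bounded_def dist_norm norm_minus_commute intro!: exI[of _ z0] exI[of _ B])
  then obtain l r where r: "strict_mono r" and l: "((\<lambda>n. x (Suc (k n))) \<circ> r) \<longlonglongrightarrow> l"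
    using bounded_imp_convergent_subsequence by blast
  define m where "m n = k (r n)" for n
  have m_lim: "filterlim m sequentially sequentially"
    unfolding m_def by (rule filterlim_compose[OF k_lim filterlim_subseq[OF r]])
  have x_lim: "(\<lambda>n. x (Suc (m n))) \<longlonglongrightarrow> l"
    using l by (simp add: o_def m_def)
  have "(\<lambda>n. x (Suc (m n)) - p (m n)) \<longlonglongrightarrow> 0"
    using filterlim_compose[OF e_lim m_lim] by (simp add: e_def tendsto_norm_zero_iff)
  from tendsto_diff[OF x_lim this] have "(\<lambda>n. p (m n)) \<longlonglongrightarrow> l"
    by simp
  then have Fp: "(\<lambda>n. F (p (m n))) \<longlonglongrightarrow> F l"
    using continuous_on_tendsto_compose[OF lipschitz_on_continuous_on[OF lip]] by simp
  have inv: "(\<lambda>n. F z0 + inverse (real (Suc (r n)))) \<longlonglongrightarrow> F z0 + 0"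
    using LIMSEQ_subseq_LIMSEQ[OF LIMSEQ_inverse_real_of_nat r]
    by (intro tendsto_add tendsto_const) (simp add: o_def)
  have "F (p (m n)) \<le> F z0 + inverse (real (Suc (r n)))" for n
    using k(2)[of "r n"] by (simp add: m_def)
  then have "F l \<le> F z0 + 0"
    by (intro LIMSEQ_le[OF Fp inv]) auto
  then have l_min: "F l \<le> F y" for y
    using z0[of y] by linarith
  obtain c where c: "(\<lambda>k. norm (x k - l)) \<longlonglongrightarrow> c"
    using dist_conv[OF l_min] by (auto simp: convergent_def)
  have "(\<lambda>n. norm (x (Suc (m n)) - l)) \<longlonglongrightarrow> c"
    using filterlim_compose[OF LIMSEQ_Suc[OF c] m_lim] .
  moreover have "(\<lambda>n. norm (x (Suc (m n)) - l)) \<longlonglongrightarrow> 0"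
    by (rule tendsto_norm_zero) (rule LIM_zero[OF x_lim])
  ultimately have "c = 0"
    by (rule LIMSEQ_unique)
  with c have "(\<lambda>k. x k - l) \<longlonglongrightarrow> 0"
    by (simp add: tendsto_norm_zero_iff)
  then have "x \<longlonglongrightarrow> l"
    by (rule LIM_zero_cancel)
  with l_min show ?thesis
    by blast
qed

section \<open>Gaussian integrals of the weights\<close>

text \<open>The density factors over the orthonormal basis into one-dimensional normal densities
  with standard deviation \<open>sqrt v\<close>.\<close>

lemma gaussian_normalized:
  fixes \<mu> :: "real ^ 'n"
  assumes v: "v > 0"
  shows "(\<integral>\<^sup>+z. ennreal (exp (- (norm (z - \<mu>))\<^sup>2 / (2 * v)) / sqrt (2 * pi * v) ^ CARD('n)) \<partial>lborel) = 1"
proof -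
  have factors: "exp (- (norm (z - \<mu>))\<^sup>2 / (2 * v)) / sqrt (2 * pi * v) ^ CARD('n)
      = (\<Prod>b\<in>Basis. normal_density (\<mu> \<bullet> b) (sqrt v) (z \<bullet> b))" for z :: "real ^ 'n"
  proof -
    have "(norm (z - \<mu>))\<^sup>2 = (\<Sum>b\<in>Basis. (z \<bullet> b - \<mu> \<bullet> b)\<^sup>2)"
      unfolding power2_norm_eq_inner
      by (subst euclidean_inner) (simp add: inner_diff_left power2_eq_square)
    then show ?thesis
      using v by (simp add: normal_density_def prod.distrib prod_dividef exp_sum[symmetric]
        sum_negf sum_divide_distrib[symmetric])
  qed
  have "(\<integral>\<^sup>+z. (\<Prod>b\<in>Basis. ennreal (normal_density (\<mu> \<bullet> b) (sqrt v) (z \<bullet> b))) \<partial>lborel)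
      = (\<Prod>b\<in>Basis. \<integral>\<^sup>+y. ennreal (normal_density (\<mu> \<bullet> b) (sqrt v) y) \<partial>lborel)"
    by (rule nn_integral_lborel_prod) auto
  also have "\<dots> = 1"
    using v by (simp add: nn_integral_eq_integral)
  finally show ?thesis
    unfolding factors by (simp add: prod_ennreal)
qed

lemma sets_gaussian [simp, measurable_cong]: "sets (gaussian \<mu> v) = sets borel"
  by (simp add: gaussian_def)

lemma space_gaussian [simp]: "space (gaussian \<mu> v) = UNIV"
  by (simp add: gaussian_def)

lemma nn_integral_gaussian:
  fixes \<mu> :: "real ^ 'n"
  assumes [measurable]: "h \<in> borel_measurable borel"
  shows "(\<integral>\<^sup>+z. h z \<partial>gaussian \<mu> v) =
    (\<integral>\<^sup>+z. ennreal (exp (- (norm (z - \<mu>))\<^sup>2 / (2 * v)) / sqrt (2 * pi * v) ^ CARD('n)) * h z \<partial>lborel)"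
  unfolding gaussian_def by (subst nn_integral_density) auto

lemma prob_space_gaussian: "v > 0 \<Longrightarrow> prob_space (gaussian \<mu> v)"
  using gaussian_normalized[of v \<mu>] by (intro prob_spaceI) (simp add: gaussian_def emeasure_density)

lemma nn_integral_lborel_affine:
  fixes a :: "'a::euclidean_space"
  assumes [measurable]: "h \<in> borel_measurable borel" and "c \<noteq> 0"
  shows "(\<integral>\<^sup>+z. h z \<partial>lborel) = ennreal (\<bar>c\<bar> ^ DIM('a)) * (\<integral>\<^sup>+z. h (a + c *\<^sub>R z) \<partial>lborel)"
  by (subst lborel_affine[OF \<open>c \<noteq> 0\<close>, of a])
     (simp add: nn_integral_density nn_integral_distr nn_integral_cmult)

text \<open>This makes a Gaussian with random centre a random shift of one fixed law, the form
  needed for the disintegration.\<close>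

lemma gaussian_eq_translation:
  fixes \<mu> :: "real ^ 'n"
  shows "gaussian \<mu> v = distr (gaussian 0 v) borel (\<lambda>z. \<mu> + z)"
proof (rule measure_eqI)
  fix A assume "A \<in> sets (gaussian \<mu> v)"
  then have [measurable]: "A \<in> sets borel"
    by simp
  have "emeasure (gaussian \<mu> v) A = (\<integral>\<^sup>+z. indicator A z \<partial>gaussian \<mu> v)"
    by simp
  also have "\<dots> = (\<integral>\<^sup>+z. indicator A (\<mu> + z) \<partial>gaussian 0 v)"
    by (subst (1 2) nn_integral_gaussian, simp, simp,
        subst nn_integral_lborel_affine[where a = \<mu> and c = 1]) simp_all
  also have "\<dots> = emeasure (distr (gaussian 0 v) borel (\<lambda>z. \<mu> + z)) A"
    by (subst nn_integral_distr[symmetric, of "\<lambda>z. \<mu> + z" _ borel "indicator A"]) simp_all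
  finally show "emeasure (gaussian \<mu> v) A = emeasure (distr (gaussian 0 v) borel (\<lambda>z. \<mu> + z)) A" .
qed simp

text \<open>The exponents of the two sides differ by a completed square, so that the second moment of the
  weights is controlled by the mass of a Gaussian centred at the reflection \<open>2 p - x\<close>.\<close>

lemma gaussian_weight_second_moment:
  fixes F :: "real ^ 'n \<Rightarrow> real"
  assumes sub: "\<And>z. F p + (x - p) \<bullet> (z - p) / t \<le> F z"
    and t: "t > 0" and \<delta>: "\<delta> > 0" and [measurable]: "F \<in> borel_measurable borel"
  shows "(\<integral>\<^sup>+z. ennreal ((exp (- F z / \<delta>))\<^sup>2) \<partial>gaussian x (\<delta> * t)) \<le> ennreal ((exp (- F p / \<delta>))\<^sup>2)"
proof -
  let ?c = "sqrt (2 * pi * (\<delta> * t)) ^ CARD('n)"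
  have le: "- (norm (z - x))\<^sup>2 / (2 * (\<delta> * t)) + 2 * (- F z / \<delta>)
      \<le> 2 * (- F p / \<delta>) + - (norm (z - (2 *\<^sub>R p - x)))\<^sup>2 / (2 * (\<delta> * t))" for z
  proof -
    have "(norm (z - (2 *\<^sub>R p - x)))\<^sup>2 = (norm (z - x))\<^sup>2 + 4 * ((x - p) \<bullet> (z - p))"
      by (simp only: power2_norm_eq_inner inner_diff_left inner_diff_right inner_scaleR_left
          inner_scaleR_right) (simp add: inner_commute algebra_simps)
    then have "(norm (z - (2 *\<^sub>R p - x)))\<^sup>2 / (2 * (\<delta> * t))
        = (norm (z - x))\<^sup>2 / (2 * (\<delta> * t)) + 2 * ((x - p) \<bullet> (z - p) / t / \<delta>)"
      by (simp add: add_divide_distrib mult_ac)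
    moreover have "(F p + (x - p) \<bullet> (z - p) / t) / \<delta> \<le> F z / \<delta>"
      using sub[of z] \<delta> by (simp add: divide_right_mono)
    ultimately show ?thesis
      by (simp add: add_divide_distrib)
  qed
  have "exp (- (norm (z - x))\<^sup>2 / (2 * (\<delta> * t))) / ?c * (exp (- F z / \<delta>))\<^sup>2
      \<le> (exp (- F p / \<delta>))\<^sup>2 * (exp (- (norm (z - (2 *\<^sub>R p - x)))\<^sup>2 / (2 * (\<delta> * t))) / ?c)" for z
  proof -
    have "exp (- (norm (z - x))\<^sup>2 / (2 * (\<delta> * t)) + 2 * (- F z / \<delta>)) / ?c
        \<le> exp (2 * (- F p / \<delta>) + - (norm (z - (2 *\<^sub>R p - x)))\<^sup>2 / (2 * (\<delta> * t))) / ?c"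
      using le[of z] t \<delta> by (intro divide_right_mono) auto
    then show ?thesis
      unfolding exp_add exp_double by simp
  qed
  then have "(\<integral>\<^sup>+z. ennreal ((exp (- F z / \<delta>))\<^sup>2) \<partial>gaussian x (\<delta> * t))
    \<le> (\<integral>\<^sup>+z. ennreal ((exp (- F p / \<delta>))\<^sup>2) * ennreal (exp (- (norm (z - (2 *\<^sub>R p - x)))\<^sup>2 / (2 * (\<delta> * t))) / ?c) \<partial>lborel)"
    using t \<delta> by (subst nn_integral_gaussian) (auto intro!: nn_integral_mono ennreal_leI simp: ennreal_mult'[symmetric])
  also have "\<dots> = ennreal ((exp (- F p / \<delta>))\<^sup>2)"
    using t \<delta> by (subst nn_integral_cmult, simp, subst gaussian_normalized) simp_all
  finally show ?thesis .
qed

text \<open>The integrand dominates a multiple of the Gaussian density centred at \<open>p\<close>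
  with variance \<delta> t / 5 per coordinate. The ratio of the two normalizing constants produces
  the power of \<open>sqrt 5\<close>.\<close>

lemma gaussian_weight_mean_ge:
  fixes F :: "real ^ 'n \<Rightarrow> real"
  assumes lip: "\<Lambda>-lipschitz_on UNIV F" and xp: "norm (x - p) \<le> t * \<Lambda>"
    and t: "t > 0" and \<delta>: "\<delta> > 0"
  shows "ennreal (exp (- F p / \<delta> - \<Lambda>\<^sup>2 * t / \<delta>) / sqrt 5 ^ CARD('n))
    \<le> (\<integral>\<^sup>+z. ennreal (exp (- F z / \<delta>)) \<partial>gaussian x (\<delta> * t))"
proof -
  have [measurable]: "F \<in> borel_measurable borel"
    using lip by (intro borel_measurable_continuous_onI lipschitz_on_continuous_on)
  let ?c = "sqrt (2 * pi * (\<delta> * t)) ^ CARD('n)" and ?c' = "sqrt (2 * pi * (\<delta> * t / 5)) ^ CARD('n)"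
  let ?k = "exp (- F p / \<delta> - \<Lambda>\<^sup>2 * t / \<delta>)"
  have c: "?c = sqrt 5 ^ CARD('n) * ?c'"
    by (simp only: power_mult_distrib[symmetric] real_sqrt_mult[symmetric]) (simp add: mult.assoc)
  have le: "(- F p / \<delta> - \<Lambda>\<^sup>2 * t / \<delta>) + - (norm (z - p))\<^sup>2 / (2 * (\<delta> * t / 5))
      \<le> - (norm (z - x))\<^sup>2 / (2 * (\<delta> * t)) + - F z / \<delta>" for z
  proof -
    define u where "u = norm (z - p)"
    have Fz: "F z \<le> F p + \<Lambda> * u"
      using lipschitz_onD[OF lip, of z p] by (simp add: dist_norm u_def)
    have "norm (z - x) \<le> u + t * \<Lambda>"
      using norm_triangle_ineq[of "z - p" "p - x"] xp by (simp add: u_def norm_minus_commute)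
    then have zx: "(norm (z - x))\<^sup>2 \<le> (u + t * \<Lambda>)\<^sup>2"
      by (simp add: power_mono)
    \<comment> \<open>This absorbs the mixed term 4 t \<Lambda> u, collected from \<open>zx\<close>
      and from 2 t times \<open>Fz\<close>, into 4 u^2 + t^2 \<Lambda>^2; together with the u^2
      already present it gives the factor 5.\<close>
    have "0 \<le> (t * \<Lambda> - 2 * u)\<^sup>2"
      by simp
    then have "(norm (z - x))\<^sup>2 + 2 * t * F z \<le> 5 * u\<^sup>2 + 2 * t * F p + 2 * \<Lambda>\<^sup>2 * t * t"
      using zx mult_left_mono[OF Fz, of "2 * t"] t
      by (simp add: power2_eq_square algebra_simps)
    then have "((norm (z - x))\<^sup>2 + 2 * t * F z) / (2 * (\<delta> * t)) \<le> (5 * u\<^sup>2 + 2 * t * F p + 2 * \<Lambda>\<^sup>2 * t * t) / (2 * (\<delta> * t))"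
      using t \<delta> by (intro divide_right_mono) auto
    then show ?thesis
      using t \<delta> by (simp add: add_divide_distrib diff_divide_distrib u_def)
  qed
  have "ennreal (?k / sqrt 5 ^ CARD('n))
      = (\<integral>\<^sup>+z. ennreal (?k / sqrt 5 ^ CARD('n)) * ennreal (exp (- (norm (z - p))\<^sup>2 / (2 * (\<delta> * t / 5))) / ?c') \<partial>lborel)"
    using t \<delta> by (subst nn_integral_cmult, simp, subst gaussian_normalized) simp_all
  also have "\<dots> \<le> (\<integral>\<^sup>+z. ennreal (exp (- F z / \<delta>)) \<partial>gaussian x (\<delta> * t))"
  proof (subst nn_integral_gaussian, simp, rule nn_integral_mono)
    fix z :: "real ^ 'n"
    have "?k / sqrt 5 ^ CARD('n) * (exp (- (norm (z - p))\<^sup>2 / (2 * (\<delta> * t / 5))) / ?c')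
        = exp ((- F p / \<delta> - \<Lambda>\<^sup>2 * t / \<delta>) + - (norm (z - p))\<^sup>2 / (2 * (\<delta> * t / 5))) / ?c"
      unfolding c exp_add by simp
    also have "\<dots> \<le> exp (- (norm (z - x))\<^sup>2 / (2 * (\<delta> * t)) + - F z / \<delta>) / ?c"
      using le[of z] t \<delta> by (intro divide_right_mono) auto
    also have "\<dots> = exp (- (norm (z - x))\<^sup>2 / (2 * (\<delta> * t))) / ?c * exp (- F z / \<delta>)"
      unfolding exp_add by simp
    finally show "ennreal (?k / sqrt 5 ^ CARD('n)) * ennreal (exp (- (norm (z - p))\<^sup>2 / (2 * (\<delta> * t / 5))) / ?c')
        \<le> ennreal (exp (- (norm (z - x))\<^sup>2 / (2 * (\<delta> * t))) / ?c) * ennreal (exp (- F z / \<delta>))"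
      using t \<delta> by (simp add: ennreal_mult'[symmetric] ennreal_leI)
  qed
  finally show ?thesis .
qed

text \<open>Halving the distance to the minimizer \<open>p\<close> of \<open>F + |\<cdot> - x|\<^sup>2 / (2 t)\<close> decreases this function by at
  least \<open>3 |z - p|\<^sup>2 / (8 t)\<close>, by strong convexity, while it changes the volume only by the factor \<open>2\<close> to
  the power \<open>n\<close>. This replaces an integration by parts, for which \<open>F\<close> is not smooth enough.\<close>

lemma gaussian_weight_spread:
  fixes F :: "real ^ 'n \<Rightarrow> real"
  assumes sub: "\<And>z. F p + (x - p) \<bullet> (z - p) / t \<le> F z" and convex: "convex_on UNIV F"
    and t: "t > 0" and \<delta>: "\<delta> > 0" and [measurable]: "F \<in> borel_measurable borel"
  shows "(\<integral>\<^sup>+z. ennreal (exp (- F z / \<delta>) * (norm (z - p))\<^sup>2) \<partial>gaussian x (\<delta> * t))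
    \<le> ennreal (8 / 3 * 2 ^ CARD('n) * (\<delta> * t)) * (\<integral>\<^sup>+z. ennreal (exp (- F z / \<delta>)) \<partial>gaussian x (\<delta> * t))"
proof -
  let ?c = "sqrt (2 * pi * (\<delta> * t)) ^ CARD('n)"
  define G where "G z = exp (- (norm (z - x))\<^sup>2 / (2 * (\<delta> * t))) / ?c * exp (- F z / \<delta>)" for z
  have [measurable]: "G \<in> borel_measurable borel"
    unfolding G_def by measurable
  define h where "h z = (1 / 2) *\<^sub>R p + (1 / 2) *\<^sub>R z" for z :: "real ^ 'n"
  have [measurable]: "h \<in> borel_measurable borel"
    unfolding h_def by measurable
  have le: "G z * (norm (z - p))\<^sup>2 \<le> 8 / 3 * (\<delta> * t) * G (h z)" for z
  proof -
    define a where "a = 3 * (norm (z - p))\<^sup>2 / (8 * t) / \<delta>"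
    have "F (h z) \<le> (F p + F z) / 2"
      using convex_onD[OF convex, of "1/2" p z] by (simp add: h_def)
    with sub[of z] have 1: "F (h z) + (x - p) \<bullet> (z - p) / (2 * t) \<le> F z"
      by (simp add: field_simps)
    have "(norm (h z - x))\<^sup>2 = (norm (z - x))\<^sup>2 + (x - p) \<bullet> (z - p) - 3 / 4 * (norm (z - p))\<^sup>2"
      unfolding h_def
      by (simp only: power2_norm_eq_inner inner_diff_left inner_diff_right inner_add_left inner_add_right
          inner_scaleR_left inner_scaleR_right) (simp add: inner_commute field_simps)
    then have "(norm (h z - x))\<^sup>2 / (2 * t)
        = (norm (z - x))\<^sup>2 / (2 * t) + (x - p) \<bullet> (z - p) / (2 * t) - 3 * (norm (z - p))\<^sup>2 / (8 * t)"
      by (simp add: add_divide_distrib diff_divide_distrib)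
    with 1 have "(norm (h z - x))\<^sup>2 / (2 * t) + F (h z) + 3 * (norm (z - p))\<^sup>2 / (8 * t)
        \<le> (norm (z - x))\<^sup>2 / (2 * t) + F z"
      by linarith
    then have "((norm (h z - x))\<^sup>2 / (2 * t) + F (h z) + 3 * (norm (z - p))\<^sup>2 / (8 * t)) / \<delta>
        \<le> ((norm (z - x))\<^sup>2 / (2 * t) + F z) / \<delta>"
      using \<delta> by (intro divide_right_mono) auto
    then have exponents: "a + (- (norm (z - x))\<^sup>2 / (2 * (\<delta> * t)) + - F z / \<delta>)
        \<le> - (norm (h z - x))\<^sup>2 / (2 * (\<delta> * t)) + - F (h z) / \<delta>"
      by (simp add: a_def add_divide_distrib mult_ac)
    \<comment> \<open>The gain \<open>a\<close> in the exponent pays for the quadratic factor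
      through a \<le> exp a; solving the definition of \<open>a\<close> for |z - p|^2 gives the
      constant 8/3.\<close>
    have "a * G z \<le> exp a * G z"
      using exp_ge_add_one_self[of a] t \<delta> by (intro mult_right_mono) (linarith, simp add: G_def)
    also have "\<dots> = exp (a + (- (norm (z - x))\<^sup>2 / (2 * (\<delta> * t)) + - F z / \<delta>)) / ?c"
      unfolding G_def exp_add by simp
    also have "\<dots> \<le> exp (- (norm (h z - x))\<^sup>2 / (2 * (\<delta> * t)) + - F (h z) / \<delta>) / ?c"
      using exponents t \<delta> by (intro divide_right_mono) auto
    also have "\<dots> = G (h z)"
      unfolding G_def exp_add by simp
    finally have "a * G z \<le> G (h z)" .
    have "G z * (norm (z - p))\<^sup>2 = 8 / 3 * (\<delta> * t) * (a * G z)"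
      using t \<delta> by (simp add: a_def)
    also have "\<dots> \<le> 8 / 3 * (\<delta> * t) * G (h z)"
      using \<open>a * G z \<le> G (h z)\<close> t \<delta> by (intro mult_left_mono) auto
    finally show ?thesis .
  qed
  have G: "(\<integral>\<^sup>+z. ennreal (exp (- F z / \<delta>)) \<partial>gaussian x (\<delta> * t)) = (\<integral>\<^sup>+z. ennreal (G z) \<partial>lborel)"
    using t \<delta> by (subst nn_integral_gaussian) (auto simp: G_def ennreal_mult'[symmetric])
  have half: "(\<integral>\<^sup>+z. ennreal (G (h z)) \<partial>lborel) = ennreal (2 ^ CARD('n)) * (\<integral>\<^sup>+z. ennreal (G z) \<partial>lborel)"
    unfolding h_def
    by (subst (2) nn_integral_lborel_affine[where a = "(1 / 2) *\<^sub>R p" and c = "1 / 2"])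
       (simp_all add: mult.assoc[symmetric] ennreal_mult'[symmetric] power_one_over)
  have "(\<integral>\<^sup>+z. ennreal (exp (- F z / \<delta>) * (norm (z - p))\<^sup>2) \<partial>gaussian x (\<delta> * t))
      = (\<integral>\<^sup>+z. ennreal (G z * (norm (z - p))\<^sup>2) \<partial>lborel)"
    using t \<delta> by (subst nn_integral_gaussian) (auto simp: G_def ennreal_mult'[symmetric] mult.assoc)
  also have "\<dots> \<le> (\<integral>\<^sup>+z. ennreal (8 / 3 * (\<delta> * t)) * ennreal (G (h z)) \<partial>lborel)"
    using t \<delta> le by (intro nn_integral_mono) (simp add: ennreal_mult'[symmetric] ennreal_leI)
  also have "\<dots> = ennreal (8 / 3 * (\<delta> * t)) * (ennreal (2 ^ CARD('n)) * (\<integral>\<^sup>+z. ennreal (G z) \<partial>lborel))"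
    by (subst nn_integral_cmult) (simp_all add: half)
  also have "\<dots> = ennreal (8 / 3 * 2 ^ CARD('n) * (\<delta> * t)) * (\<integral>\<^sup>+z. ennreal (G z) \<partial>lborel)"
    using t \<delta> by (subst mult.assoc[symmetric], subst ennreal_mult'[symmetric]) (simp_all add: mult.commute mult.left_commute)
  finally show ?thesis
    unfolding G .
qed

section \<open>Self-normalized means of independent samples\<close>

text \<open>If the mean weight is below 1/2, the first term alone exceeds 1. Otherwise |y| \<le> r/2
  + |y|^2 / (2 r) is averaged with the weights, whose sum is at least half of \<open>card I\<close>.
  The length scale \<open>r\<close> is free; it will be sqrt (\<delta> t).\<close>

lemma self_normalized_sum_le:
  fixes q :: "'i \<Rightarrow> real" and y :: "'i \<Rightarrow> 'a::real_normed_vector" and r :: real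
  assumes I: "finite I" "I \<noteq> {}" and q: "\<And>i. i \<in> I \<Longrightarrow> q i > 0" and r: "r > 0"
  shows "min 1 (norm ((\<Sum>i\<in>I. q i *\<^sub>R y i) /\<^sub>R (\<Sum>i\<in>I. q i)))
    \<le> 4 * ((\<Sum>i\<in>I. q i) / card I - 1)\<^sup>2 + r / 2 + (\<Sum>i\<in>I. q i * (norm (y i))\<^sup>2) / (card I * r)"
proof -
  define S where "S = (\<Sum>i\<in>I. q i)"
  define T where "T = (\<Sum>i\<in>I. q i * (norm (y i))\<^sup>2)"
  define n where "n = real (card I)"
  have n: "n > 0"
    using I by (simp add: n_def card_gt_0_iff)
  have S: "S > 0"
    using I q unfolding S_def by (intro sum_pos) auto
  have T: "T \<ge> 0"
    unfolding T_def using q by (intro sum_nonneg) (simp add: less_imp_le)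
  show ?thesis
  proof (cases "S / n \<ge> 1 / 2")
    case True
    have "norm ((\<Sum>i\<in>I. q i *\<^sub>R y i) /\<^sub>R S) \<le> (\<Sum>i\<in>I. q i * norm (y i)) / S"
      using S q by (auto simp: divide_inverse_commute less_imp_le intro!: mult_left_mono sum_norm_le)
    also have "(\<Sum>i\<in>I. q i * norm (y i)) \<le> (\<Sum>i\<in>I. q i * (r / 2 + (norm (y i))\<^sup>2 / (2 * r)))"
    proof (intro sum_mono mult_left_mono)
      fix i
      have "0 \<le> (r - norm (y i))\<^sup>2"
        by simp
      then show "norm (y i) \<le> r / 2 + (norm (y i))\<^sup>2 / (2 * r)"
        using r by (simp add: field_simps power2_eq_square)
    qed (use q in \<open>simp add: less_imp_le\<close>)
    also have "\<dots> = S * (r / 2) + T / (2 * r)"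
      by (simp add: S_def T_def distrib_left sum.distrib sum_distrib_right sum_divide_distrib)
    also have "(S * (r / 2) + T / (2 * r)) / S = r / 2 + T / (r * (2 * S))"
      using S by (simp add: add_divide_distrib mult_ac)
    also have "\<dots> \<le> r / 2 + T / (r * n)"
      using True n r T S by (intro add_left_mono divide_left_mono mult_left_mono) (auto simp: field_simps)
    finally have "norm ((\<Sum>i\<in>I. q i *\<^sub>R y i) /\<^sub>R S) \<le> r / 2 + T / (n * r)"
      using S by (simp add: divide_right_mono mult.commute)
    then have "norm ((\<Sum>i\<in>I. q i *\<^sub>R y i) /\<^sub>R S) \<le> 4 * (S / n - 1)\<^sup>2 + r / 2 + T / (n * r)"
      using zero_le_power2[of "S / n - 1"] by linarith
    then show ?thesis
      unfolding S_def[symmetric] T_def[symmetric] n_def[symmetric] by (rule min.coboundedI2)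
  next
    case False
    then have "(1 / 2)\<^sup>2 \<le> (1 - S / n)\<^sup>2"
      by (intro power_mono) auto
    then have "1 \<le> 4 * (S / n - 1)\<^sup>2"
      by (simp add: power2_commute power_divide)
    moreover have "0 \<le> T / (n * r)"
      using T n r by simp
    ultimately show ?thesis
      using r unfolding S_def[symmetric] T_def[symmetric] n_def[symmetric] by linarith
  qed
qed

text \<open>Independence and mean zero remove the off-diagonal terms of the expanded square.\<close>

lemma (in prob_space) integral_PiM_square_sum:
  fixes h :: "'a \<Rightarrow> real" and I :: "'i set"
  assumes I: "finite I" and int: "integrable M h" "integrable M (\<lambda>z. (h z)\<^sup>2)" and mean: "expectation h = 0"
  shows "has_bochner_integral (PiM I (\<lambda>_. M)) (\<lambda>y. (\<Sum>i\<in>I. h (y i))\<^sup>2) (card I * expectation (\<lambda>z. (h z)\<^sup>2))"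
proof -
  interpret product_sigma_finite "\<lambda>_. M" ..
  \<comment> \<open>Writing h (y i) h (y j) as a product over all coordinates makes Fubini for
    products applicable; on the diagonal the factor at \<open>i\<close> becomes the square.\<close>
  define f where "f i j k z = (if k = i then h z else 1) * (if k = j then h z else 1)" for i j k :: 'i and z
  have f_int: "integrable M (f i j k)" for i j k
    using int unfolding f_def by (cases "k = i"; cases "k = j") (simp_all add: power2_eq_square)
  have prod: "(\<Prod>k\<in>I. f i j k (y k)) = h (y i) * h (y j)" if "i \<in> I" "j \<in> I" for i j y
    using I that by (simp add: f_def prod.distrib prod.delta)
  have hh: "has_bochner_integral (PiM I (\<lambda>_. M)) (\<lambda>y. h (y i) * h (y j))
      (if i = j then expectation (\<lambda>z. (h z)\<^sup>2) else 0)" if ij: "i \<in> I" "j \<in> I" for i j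
  proof -
    have "has_bochner_integral (PiM I (\<lambda>_. M)) (\<lambda>y. \<Prod>k\<in>I. f i j k (y k)) (\<Prod>k\<in>I. expectation (f i j k))"
      using I f_int by (simp add: has_bochner_integral_iff product_integrable_prod product_integral_prod)
    moreover have "(\<Prod>k\<in>I. expectation (f i j k)) = (if i = j then expectation (\<lambda>z. (h z)\<^sup>2) else 0)"
    proof (cases "i = j")
      case True
      have "expectation (f i j k) = (if k = i then expectation (\<lambda>z. (h z)\<^sup>2) else 1)" for k
        using True by (simp add: f_def[abs_def] power2_eq_square prob_space)
      then show ?thesis
        using I ij True by (simp add: prod.delta)
    next
      case False
      then have "expectation (f i j i) = 0"
        by (simp add: f_def[abs_def] mean)
      then show ?thesis
        using I ij False by (auto intro!: prod_zero)
    qed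
    ultimately show ?thesis
      using prod[OF ij] by simp
  qed
  have "has_bochner_integral (PiM I (\<lambda>_. M)) (\<lambda>y. \<Sum>i\<in>I. \<Sum>j\<in>I. h (y i) * h (y j))
      (\<Sum>i\<in>I. \<Sum>j\<in>I. if i = j then expectation (\<lambda>z. (h z)\<^sup>2) else 0)"
    by (intro has_bochner_integral_sum hh)
  then show ?thesis
    using I by (simp add: power2_eq_square sum_product sum.delta)
qed

lemma (in prob_space) nn_integral_PiM_component:
  assumes "i \<in> I" and [measurable]: "h \<in> borel_measurable M"
  shows "(\<integral>\<^sup>+y. h (y i) \<partial>PiM I (\<lambda>_. M)) = (\<integral>\<^sup>+z. h z \<partial>M)"
proof -
  have "(\<integral>\<^sup>+z. h z \<partial>M) = (\<integral>\<^sup>+z. h z \<partial>distr (PiM I (\<lambda>_. M)) M (\<lambda>y. y i))"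
    using assms prob_space_axioms by (subst distr_PiM_component) auto
  also have "\<dots> = (\<integral>\<^sup>+y. h (y i) \<partial>PiM I (\<lambda>_. M))"
    using assms by (subst nn_integral_distr) auto
  finally show ?thesis by simp
qed

text \<open>Integrate the pointwise bound for the weights \<open>q\<close>, normalized to mean 1:
  the fluctuation term contributes 4 K / card I by the variance bound, the spread term contributes D
  r.\<close>

lemma (in prob_space) self_normalized_mean_error:
  fixes w :: "'a \<Rightarrow> real" and \<phi> :: "'a \<Rightarrow> 'b::euclidean_space"
  assumes I: "finite I" "I \<noteq> {}" and r: "r > 0" and m: "m > 0" and D: "D \<ge> 0" and K: "K \<ge> 0"
    and [measurable]: "w \<in> borel_measurable M" "\<phi> \<in> borel_measurable M" and w: "\<And>z. w z > 0"
    and mean: "(\<integral>\<^sup>+z. ennreal (w z) \<partial>M) = ennreal m"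
    and square: "(\<integral>\<^sup>+z. ennreal ((w z)\<^sup>2) \<partial>M) \<le> ennreal (K * m\<^sup>2)"
    and spread: "(\<integral>\<^sup>+z. ennreal (w z * (norm (\<phi> z))\<^sup>2) \<partial>M) \<le> ennreal (D * r\<^sup>2 * m)"
  shows "(\<integral>\<^sup>+y. ennreal (min 1 (norm ((\<Sum>i\<in>I. w (y i) *\<^sub>R \<phi> (y i)) /\<^sub>R (\<Sum>i\<in>I. w (y i))))) \<partial>PiM I (\<lambda>_. M))
    \<le> ennreal (4 * K / card I + (1 / 2 + D) * r)"
proof -
  define q where "q z = w z / m" for z
  define n where "n = real (card I)"
  have n: "n > 0"
    using I by (simp add: n_def card_gt_0_iff)
  have q: "q z > 0" for z
    using w m by (simp add: q_def)
  have q_meas [measurable]: "q \<in> borel_measurable M"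
    unfolding q_def by measurable
  interpret PiM: prob_space "PiM I (\<lambda>_. M)"
    by (intro prob_space_PiM prob_space_axioms)
  have w_int: "integrable M w" "expectation w = m"
    using mean w m by (auto intro!: integrableI_nonneg simp: less_imp_le integral_eq_nn_integral)
  have w2_int: "integrable M (\<lambda>z. (w z)\<^sup>2)"
    using square by (intro integrableI_nonneg) (auto simp: top_unique less_top[symmetric])
  have w2: "expectation (\<lambda>z. (w z)\<^sup>2) \<le> K * m\<^sup>2"
    using square K by (simp add: nn_integral_eq_integral[OF w2_int] ennreal_le_iff)
  define h where "h z = q z - 1" for z
  have h_int: "integrable M h" "integrable M (\<lambda>z. (h z)\<^sup>2)" and h_mean: "expectation h = 0"
    using w_int w2_int m
    by (auto simp: h_def[abs_def] q_def power2_diff power_divide prob_space)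
  have h2: "expectation (\<lambda>z. (h z)\<^sup>2) \<le> K"
  proof -
    have "expectation (\<lambda>z. (h z)\<^sup>2) = expectation (\<lambda>z. (w z)\<^sup>2) / m\<^sup>2 - 1"
      using w_int w2_int m by (simp add: h_def q_def power2_diff power_divide prob_space)
    also have "\<dots> \<le> K * m\<^sup>2 / m\<^sup>2"
      using w2 m divide_right_mono[OF w2, of "m\<^sup>2"] by simp
    finally show ?thesis
      using m by simp
  qed
  have fluct: "(\<integral>\<^sup>+y. ennreal (4 * ((\<Sum>i\<in>I. q (y i)) / n - 1)\<^sup>2) \<partial>PiM I (\<lambda>_. M)) \<le> ennreal (4 * K / n)"
  proof -
    have eq: "4 * ((\<Sum>i\<in>I. q (y i)) / n - 1)\<^sup>2 = 4 / n\<^sup>2 * (\<Sum>i\<in>I. h (y i))\<^sup>2" for y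
    proof -
      have "(\<Sum>i\<in>I. q (y i)) / n - 1 = (\<Sum>i\<in>I. h (y i)) / n"
        using n by (simp add: h_def sum_subtractf n_def diff_divide_distrib)
      then show ?thesis
        by (simp add: power_divide)
    qed
    have "has_bochner_integral (PiM I (\<lambda>_. M)) (\<lambda>y. 4 / n\<^sup>2 * (\<Sum>i\<in>I. h (y i))\<^sup>2) (4 / n\<^sup>2 * (n * expectation (\<lambda>z. (h z)\<^sup>2)))"
      unfolding n_def by (intro has_bochner_integral_mult_right integral_PiM_square_sum I h_int h_mean)
    then have "(\<integral>\<^sup>+y. ennreal (4 / n\<^sup>2 * (\<Sum>i\<in>I. h (y i))\<^sup>2) \<partial>PiM I (\<lambda>_. M)) = ennreal (4 / n\<^sup>2 * (n * expectation (\<lambda>z. (h z)\<^sup>2)))"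
      by (subst nn_integral_eq_integral) (auto simp: has_bochner_integral_iff)
    also have "\<dots> \<le> ennreal (4 * K / n)"
      using h2 n by (intro ennreal_leI) (simp add: field_simps power2_eq_square)
    finally show ?thesis
      unfolding eq .
  qed
  have far: "(\<integral>\<^sup>+y. ennreal ((\<Sum>i\<in>I. q (y i) * (norm (\<phi> (y i)))\<^sup>2) / (n * r)) \<partial>PiM I (\<lambda>_. M)) \<le> ennreal (D * r)"
  proof -
    have comp: "(\<integral>\<^sup>+y. ennreal (1 / (m * n * r)) * ennreal (w (y i) * (norm (\<phi> (y i)))\<^sup>2) \<partial>PiM I (\<lambda>_. M))
        \<le> ennreal (D * r / n)" if "i \<in> I" for i
    proof -
      have "(\<integral>\<^sup>+y. ennreal (1 / (m * n * r)) * ennreal (w (y i) * (norm (\<phi> (y i)))\<^sup>2) \<partial>PiM I (\<lambda>_. M))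
          = ennreal (1 / (m * n * r)) * (\<integral>\<^sup>+z. ennreal (w z * (norm (\<phi> z))\<^sup>2) \<partial>M)"
        using that
        by (subst nn_integral_PiM_component[of i I "\<lambda>z. ennreal (1 / (m * n * r)) * ennreal (w z * (norm (\<phi> z))\<^sup>2)"])
           (auto simp: nn_integral_cmult)
      also have "\<dots> \<le> ennreal (1 / (m * n * r)) * ennreal (D * r\<^sup>2 * m)"
        by (intro mult_left_mono spread) auto
      also have "\<dots> = ennreal (D * r / n)"
        using m n r by (simp add: ennreal_mult'[symmetric] power2_eq_square)
      finally show ?thesis .
    qed
    have "(\<integral>\<^sup>+y. ennreal ((\<Sum>i\<in>I. q (y i) * (norm (\<phi> (y i)))\<^sup>2) / (n * r)) \<partial>PiM I (\<lambda>_. M))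
        = (\<integral>\<^sup>+y. (\<Sum>i\<in>I. ennreal (1 / (m * n * r)) * ennreal (w (y i) * (norm (\<phi> (y i)))\<^sup>2)) \<partial>PiM I (\<lambda>_. M))"
    proof (intro nn_integral_cong)
      fix y
      have "(\<Sum>i\<in>I. q (y i) * (norm (\<phi> (y i)))\<^sup>2) / (n * r) = (\<Sum>i\<in>I. 1 / (m * n * r) * (w (y i) * (norm (\<phi> (y i)))\<^sup>2))"
        by (simp add: q_def sum_divide_distrib mult_ac)
      then show "ennreal ((\<Sum>i\<in>I. q (y i) * (norm (\<phi> (y i)))\<^sup>2) / (n * r))
          = (\<Sum>i\<in>I. ennreal (1 / (m * n * r)) * ennreal (w (y i) * (norm (\<phi> (y i)))\<^sup>2))"
        using w m n r by (simp add: ennreal_mult'[symmetric] sum_ennreal less_imp_le)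
    qed
    also have "\<dots> = (\<Sum>i\<in>I. \<integral>\<^sup>+y. ennreal (1 / (m * n * r)) * ennreal (w (y i) * (norm (\<phi> (y i)))\<^sup>2) \<partial>PiM I (\<lambda>_. M))"
      by (intro nn_integral_sum) measurable
    also have "\<dots> \<le> (\<Sum>i\<in>I. ennreal (D * r / n))"
      by (intro sum_mono comp)
    also have "\<dots> = ennreal (D * r)"
      using D r n by (simp add: n_def ennreal_of_nat_eq_real_of_nat ennreal_mult'[symmetric])
    finally show ?thesis .
  qed
  \<comment> \<open>The normalization by \<open>m\<close> cancels in the quotient.\<close>
  have "(\<Sum>i\<in>I. w (y i) *\<^sub>R \<phi> (y i)) /\<^sub>R (\<Sum>i\<in>I. w (y i)) = (\<Sum>i\<in>I. q (y i) *\<^sub>R \<phi> (y i)) /\<^sub>R (\<Sum>i\<in>I. q (y i))" for y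
  proof -
    have "(\<Sum>i\<in>I. q (y i) *\<^sub>R \<phi> (y i)) = (1 / m) *\<^sub>R (\<Sum>i\<in>I. w (y i) *\<^sub>R \<phi> (y i))"
      by (simp add: q_def scaleR_sum_right)
    moreover have "(\<Sum>i\<in>I. q (y i)) = (\<Sum>i\<in>I. w (y i)) / m"
      by (simp add: q_def sum_divide_distrib)
    ultimately show ?thesis
      using m by (simp add: inverse_eq_divide)
  qed
  then have "(\<integral>\<^sup>+y. ennreal (min 1 (norm ((\<Sum>i\<in>I. w (y i) *\<^sub>R \<phi> (y i)) /\<^sub>R (\<Sum>i\<in>I. w (y i))))) \<partial>PiM I (\<lambda>_. M))
      \<le> (\<integral>\<^sup>+y. ennreal (4 * ((\<Sum>i\<in>I. q (y i)) / n - 1)\<^sup>2) + ennreal (r / 2)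
          + ennreal ((\<Sum>i\<in>I. q (y i) * (norm (\<phi> (y i)))\<^sup>2) / (n * r)) \<partial>PiM I (\<lambda>_. M))"
    using q r n self_normalized_sum_le[OF I _ r, of "\<lambda>i. q (_ i)" "\<lambda>i. \<phi> (_ i)"] unfolding n_def
    by (intro nn_integral_mono) (simp add: ennreal_plus[symmetric] sum_nonneg less_imp_le ennreal_leI del: ennreal_plus)
  also have "\<dots> = (\<integral>\<^sup>+y. ennreal (4 * ((\<Sum>i\<in>I. q (y i)) / n - 1)\<^sup>2) \<partial>PiM I (\<lambda>_. M)) + ennreal (r / 2)
      + (\<integral>\<^sup>+y. ennreal ((\<Sum>i\<in>I. q (y i) * (norm (\<phi> (y i)))\<^sup>2) / (n * r)) \<partial>PiM I (\<lambda>_. M))"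
    by (simp add: nn_integral_add PiM.emeasure_space_1)
  also have "\<dots> \<le> ennreal (4 * K / n) + ennreal (r / 2) + ennreal (D * r)"
    by (intro add_mono fluct far order_refl)
  also have "\<dots> = ennreal (4 * K / n + (1 / 2 + D) * r)"
    using K n r D by (simp add: ennreal_plus[symmetric] algebra_simps del: ennreal_plus)
  finally show ?thesis
    unfolding n_def .
qed

section \<open>Disintegration along conditionally independent samples\<close>

text \<open>Since \<open>X\<close> is measurable for \<open>G\<close>, the event that
  \<open>X\<close> lies in \<open>B\<close> belongs to \<open>G\<close>; integrating the prescribed
  conditional probability over it gives the joint probability, which then depends on the law of
  \<open>X\<close> only.\<close>

lemma cond_iid_rectangle:
  fixes X :: "'w \<Rightarrow> 'b::euclidean_space" and Y :: "'i \<Rightarrow> 'w \<Rightarrow> 'b"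
  assumes M: "prob_space M" and G: "subalgebra M G" and X: "X \<in> borel_measurable G"
    and Y: "\<And>i. i \<in> I \<Longrightarrow> Y i \<in> borel_measurable M" and I: "finite I"
    and \<gamma>: "prob_space \<gamma>" "sets \<gamma> = sets borel"
    and iid: "cond_iid M G I Y (\<lambda>\<omega>. distr \<gamma> borel (\<lambda>y. X \<omega> + y))"
    and B: "B \<in> sets borel" and A: "\<And>i. i \<in> I \<Longrightarrow> A i \<in> sets borel"
  shows "emeasure M {\<omega>\<in>space M. X \<omega> \<in> B \<and> (\<forall>i\<in>I. Y i \<omega> \<in> A i)}
    = (\<integral>\<^sup>+x. indicator B x * (\<Prod>i\<in>I. emeasure (distr \<gamma> borel (\<lambda>y. x + y)) (A i)) \<partial>distr M borel X)"
proof -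
  interpret M: prob_space M by fact
  interpret \<gamma>: prob_space \<gamma> by fact
  interpret finite_measure_subalgebra M G
    by standard (rule G)
  note Y[measurable] I[measurable] A[measurable] B[measurable]
  have [measurable_cong]: "sets \<gamma> = sets borel" by fact
  have X_M [measurable]: "X \<in> borel_measurable M"
    using measurable_from_subalg[OF G X] .
  define K where "K x = distr \<gamma> borel (\<lambda>y. x + y)" for x :: 'b
  have K: "prob_space (K x)" for x
    unfolding K_def by (intro \<gamma>.prob_space_distr) measurable
  \<comment> \<open>The measure of \<open>C\<close> under \<open>K x\<close> is the \<gamma>-measure
    of the section at \<open>x\<close> of the set of pairs with sum in \<open>C\<close>.\<close>
  have K_meas: "(\<lambda>x. emeasure (K x) C) \<in> borel_measurable borel" if [measurable]: "C \<in> sets borel" for C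
  proof -
    have "(\<lambda>x. emeasure \<gamma> (Pair x -` {z \<in> space (borel \<Otimes>\<^sub>M \<gamma>). fst z + snd z \<in> C})) \<in> borel_measurable borel"
      by (intro \<gamma>.measurable_emeasure_Pair) measurable
    moreover have "emeasure (K x) C = emeasure \<gamma> (Pair x -` {z \<in> space (borel \<Otimes>\<^sub>M \<gamma>). fst z + snd z \<in> C})" for x
      unfolding K_def by (subst emeasure_distr) (auto simp: space_pair_measure intro!: arg_cong[of _ _ "emeasure \<gamma>"])
    ultimately show ?thesis
      by simp
  qed
  define C where "C = {\<omega>\<in>space M. \<forall>i\<in>I. Y i \<omega> \<in> A i}"
  have C [measurable]: "C \<in> sets M"
    unfolding C_def using I by measurable
  define E where "E = X -` B \<inter> space M"
  have E: "E \<in> sets G"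
    using measurable_sets[OF X B] G by (simp add: E_def subalgebra_def)
  then have E_M [measurable]: "E \<in> sets M"
    using G by (auto simp: subalgebra_def)
  have C_int: "integrable M (indicator C :: _ \<Rightarrow> real)"
    by (simp add: integrable_indicator_iff M.emeasure_finite less_top[symmetric])
  let ?e = "real_cond_exp M G (indicator C)"
  have e_int: "integrable M (\<lambda>\<omega>. indicator E \<omega> * ?e \<omega>)"
    using integrable_mult_indicator[OF E_M real_cond_exp_int(1)[OF C_int]] by simp
  have e_eq: "AE \<omega> in M. ?e \<omega> = (\<Prod>i\<in>I. measure (K (X \<omega>)) (A i))"
    using iid A unfolding cond_iid_def K_def C_def by blast
  have "{\<omega>\<in>space M. X \<omega> \<in> B \<and> (\<forall>i\<in>I. Y i \<omega> \<in> A i)} = E \<inter> C"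
    by (auto simp: E_def C_def)
  also have "emeasure M (E \<inter> C) = ennreal (\<integral>\<omega>\<in>E. indicator C \<omega> \<partial>M)"
    by (simp add: set_lebesgue_integral_def M.emeasure_eq_measure indicator_inter_arith[symmetric])
  also have "(\<integral>\<omega>\<in>E. indicator C \<omega> \<partial>M) = (\<integral>\<omega>. indicator E \<omega> * ?e \<omega> \<partial>M)"
    by (subst real_cond_exp_intA[OF C_int E]) (simp add: set_lebesgue_integral_def)
  also have "ennreal \<dots> = (\<integral>\<^sup>+\<omega>. ennreal (indicator E \<omega> * ?e \<omega>) \<partial>M)"
    using e_eq by (intro nn_integral_eq_integral[symmetric] e_int) (auto elim!: eventually_mono intro!: mult_nonneg_nonneg prod_nonneg)
  also have "\<dots> = (\<integral>\<^sup>+\<omega>. indicator B (X \<omega>) * (\<Prod>i\<in>I. emeasure (K (X \<omega>)) (A i)) \<partial>M)"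
  proof (rule nn_integral_cong_AE, use e_eq AE_space in eventually_elim)
    fix \<omega> assume "?e \<omega> = (\<Prod>i\<in>I. measure (K (X \<omega>)) (A i))" "\<omega> \<in> space M"
    then show "ennreal (indicator E \<omega> * ?e \<omega>) = indicator B (X \<omega>) * (\<Prod>i\<in>I. emeasure (K (X \<omega>)) (A i))"
      using finite_measure.emeasure_eq_measure[OF prob_space.finite_measure[OF K]]
      by (auto simp: E_def prod_ennreal split: split_indicator)
  qed
  also have "\<dots> = (\<integral>\<^sup>+x. indicator B x * (\<Prod>i\<in>I. emeasure (K x) (A i)) \<partial>distr M borel X)"
    using K_meas A by (subst nn_integral_distr) (auto intro!: borel_measurable_times_ennreal borel_measurable_prod_ennreal)
  finally show ?thesis
    unfolding K_def .
qed

text \<open>The conditioning variable \<open>X\<close> is stored as an additional coordinate \<open>i0\<close>, so that a single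
  finite product space carries the joint law.\<close>

lemma cond_iid_joint_law:
  fixes X :: "'w \<Rightarrow> 'b::euclidean_space" and Y :: "'i \<Rightarrow> 'w \<Rightarrow> 'b"
  assumes M: "prob_space M" and G: "subalgebra M G" and X: "X \<in> borel_measurable G"
    and Y: "\<And>i. i \<in> I \<Longrightarrow> Y i \<in> borel_measurable M" and I: "finite I" and i0: "i0 \<notin> I"
    and \<gamma>: "prob_space \<gamma>" "sets \<gamma> = sets borel"
    and iid: "cond_iid M G I Y (\<lambda>\<omega>. distr \<gamma> borel (\<lambda>y. X \<omega> + y))"
  shows "distr M (PiM (insert i0 I) (\<lambda>_. borel)) (\<lambda>\<omega>. \<lambda>i\<in>insert i0 I. if i = i0 then X \<omega> else Y i \<omega>)
    = distr (distr M borel X \<Otimes>\<^sub>M PiM I (\<lambda>_. \<gamma>)) (PiM (insert i0 I) (\<lambda>_. borel))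
        (\<lambda>(x, y). \<lambda>i\<in>insert i0 I. if i = i0 then x else x + y i)"
    (is "distr M ?P ?f = distr ?Q ?P ?g")
proof -
  interpret M: prob_space M by fact
  interpret \<gamma>: prob_space \<gamma> by fact
  note Y[measurable]
  have [measurable_cong]: "sets \<gamma> = sets borel" by fact
  have space_\<gamma>: "space \<gamma> = UNIV"
    using sets_eq_imp_space_eq[OF \<gamma>(2)] by simp
  have X_M [measurable]: "X \<in> borel_measurable M"
    using measurable_from_subalg[OF G X] .
  interpret N: prob_space "PiM I (\<lambda>_. \<gamma>)"
    by (intro prob_space_PiM \<gamma>)
  interpret N: product_prob_space "\<lambda>_. \<gamma>" I ..
  have f [measurable]: "?f \<in> measurable M ?P"
    by (intro measurable_restrict) (auto intro: Y)
  have g [measurable]: "?g \<in> measurable ?Q ?P"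
    unfolding split_beta' by (intro measurable_restrict) (auto intro!: borel_measurable_add measurable_compose[OF measurable_snd] simp: measurable_component_singleton)
  interpret P: prob_space "distr M ?P ?f"
    by (intro M.prob_space_distr f)
  show ?thesis
  proof (rule measure_eqI_PiM_finite)
    fix A assume A: "\<And>i. i \<in> insert i0 I \<Longrightarrow> A i \<in> sets (borel :: 'b measure)"
    then have [measurable]: "A i0 \<in> sets borel" "\<And>i. i \<in> I \<Longrightarrow> A i \<in> sets borel"
      by auto
    have PA: "PiE (insert i0 I) A \<in> sets ?P"
      using A I by (intro sets_PiM_I_finite) auto
    have "?f -` PiE (insert i0 I) A \<inter> space M = {\<omega>\<in>space M. X \<omega> \<in> A i0 \<and> (\<forall>i\<in>I. Y i \<omega> \<in> A i)}"
      using i0 by (auto simp: PiE_iff split: if_splits)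
    then have "emeasure (distr M ?P ?f) (PiE (insert i0 I) A)
        = emeasure M {\<omega>\<in>space M. X \<omega> \<in> A i0 \<and> (\<forall>i\<in>I. Y i \<omega> \<in> A i)}"
      using emeasure_distr[OF f PA] by simp
    also have "\<dots> = (\<integral>\<^sup>+x. indicator (A i0) x * (\<Prod>i\<in>I. emeasure (distr \<gamma> borel (\<lambda>y. x + y)) (A i)) \<partial>distr M borel X)"
      using A by (intro cond_iid_rectangle[OF M G X Y I \<gamma> iid]) auto
    also have "\<dots> = (\<integral>\<^sup>+x. emeasure (PiM I (\<lambda>_. \<gamma>)) (Pair x -` (?g -` PiE (insert i0 I) A \<inter> space ?Q)) \<partial>distr M borel X)"
    proof (intro nn_integral_cong)
      fix x
      \<comment> \<open>The section at \<open>x\<close> is a box of translated sets or empty, so the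
        product formula reproduces the integrand of the rectangle formula.\<close>
      have "Pair x -` (?g -` PiE (insert i0 I) A \<inter> space ?Q)
          = (if x \<in> A i0 then PiE I (\<lambda>i. (\<lambda>y. x + y) -` A i) else {})"
        using i0 by (auto simp: PiE_iff space_pair_measure space_PiM space_\<gamma> split: if_splits)
      moreover have "emeasure (PiM I (\<lambda>_. \<gamma>)) (PiE I (\<lambda>i. (\<lambda>y. x + y) -` A i))
          = (\<Prod>i\<in>I. emeasure \<gamma> ((\<lambda>y. x + y) -` A i))"
        using I measurable_sets[of "\<lambda>y. x + y" \<gamma> borel] by (intro N.emeasure_PiM) (auto simp: space_\<gamma>)
      moreover have "emeasure (distr \<gamma> borel (\<lambda>y. x + y)) (A i) = emeasure \<gamma> ((\<lambda>y. x + y) -` A i)" if "i \<in> I" for i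
        using that by (subst emeasure_distr) (auto simp: space_\<gamma>)
      ultimately show "indicator (A i0) x * (\<Prod>i\<in>I. emeasure (distr \<gamma> borel (\<lambda>y. x + y)) (A i))
          = emeasure (PiM I (\<lambda>_. \<gamma>)) (Pair x -` (?g -` PiE (insert i0 I) A \<inter> space ?Q))"
        by simp
    qed
    also have "\<dots> = emeasure ?Q (?g -` PiE (insert i0 I) A \<inter> space ?Q)"
      by (intro N.emeasure_pair_measure_alt[symmetric] measurable_sets[OF g PA])
    also have "\<dots> = emeasure (distr ?Q ?P ?g) (PiE (insert i0 I) A)"
      using emeasure_distr[OF g PA] by simp
    finally show "emeasure (distr M ?P ?f) (PiE (insert i0 I) A) = emeasure (distr ?Q ?P ?g) (PiE (insert i0 I) A)" .
  next
    show "range (\<lambda>_::nat. space ?P) \<subseteq> prod_algebra (insert i0 I) (\<lambda>_. borel)"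
      using I by (auto simp: space_PiM intro!: prod_algebraI_finite[of _ "\<lambda>_. UNIV", simplified])
  qed (use I in \<open>auto simp: P.emeasure_finite\<close>)
qed

text \<open>The conditioning variable may be frozen: by the joint law and Tonelli, a bound uniform
  in the fixed value \<open>x\<close> survives integration over the law of \<open>X\<close>.\<close>

lemma cond_iid_nn_integral_le:
  fixes X :: "'w \<Rightarrow> 'b::euclidean_space" and Y :: "'i \<Rightarrow> 'w \<Rightarrow> 'b"
  assumes M: "prob_space M" and G: "subalgebra M G" and X: "X \<in> borel_measurable G"
    and Y: "\<And>i. i \<in> I \<Longrightarrow> Y i \<in> borel_measurable M" and I: "finite I" and i0: "i0 \<notin> I"
    and \<gamma>: "prob_space \<gamma>" "sets \<gamma> = sets borel"
    and iid: "cond_iid M G I Y (\<lambda>\<omega>. distr \<gamma> borel (\<lambda>y. X \<omega> + y))"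
    and \<Phi>: "\<Phi> \<in> borel_measurable (PiM (insert i0 I) (\<lambda>_. borel))"
    and bound: "\<And>x. (\<integral>\<^sup>+y. \<Phi> (\<lambda>i\<in>insert i0 I. if i = i0 then x else x + y i) \<partial>PiM I (\<lambda>_. \<gamma>)) \<le> c"
  shows "(\<integral>\<^sup>+\<omega>. \<Phi> (\<lambda>i\<in>insert i0 I. if i = i0 then X \<omega> else Y i \<omega>) \<partial>M) \<le> c"
proof -
  interpret M: prob_space M by fact
  note Y[measurable] \<Phi>[measurable]
  have [measurable_cong]: "sets \<gamma> = sets borel" by fact
  have X_M [measurable]: "X \<in> borel_measurable M"
    using measurable_from_subalg[OF G X] .
  interpret N: prob_space "PiM I (\<lambda>_. \<gamma>)"
    by (intro prob_space_PiM \<gamma>)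
  interpret \<mu>: prob_space "distr M borel X"
    by (rule M.prob_space_distr) measurable
  let ?P = "PiM (insert i0 I) (\<lambda>_. borel :: 'b measure)"
  let ?f = "\<lambda>\<omega>. \<lambda>i\<in>insert i0 I. if i = i0 then X \<omega> else Y i \<omega>"
  let ?g = "\<lambda>(x, y). \<lambda>i\<in>insert i0 I. if i = i0 then x else x + y i"
  let ?Q = "distr M borel X \<Otimes>\<^sub>M PiM I (\<lambda>_. \<gamma>)"
  have f: "?f \<in> measurable M ?P"
    by (intro measurable_restrict) (auto intro: Y)
  have g [measurable]: "?g \<in> measurable ?Q ?P"
    unfolding split_beta' by (intro measurable_restrict) (auto intro!: borel_measurable_add measurable_compose[OF measurable_snd] simp: measurable_component_singleton)
  have "(\<integral>\<^sup>+\<omega>. \<Phi> (?f \<omega>) \<partial>M) = (\<integral>\<^sup>+z. \<Phi> z \<partial>distr M ?P ?f)"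
    by (rule nn_integral_distr[OF f, symmetric]) simp
  also have "\<dots> = (\<integral>\<^sup>+z. \<Phi> z \<partial>distr ?Q ?P ?g)"
    using cond_iid_joint_law[OF M G X Y I i0 \<gamma> iid] by simp
  also have "\<dots> = (\<integral>\<^sup>+z. \<Phi> (?g z) \<partial>?Q)"
    by (rule nn_integral_distr[OF g]) simp
  also have "\<dots> = (\<integral>\<^sup>+x. \<integral>\<^sup>+y. \<Phi> (?g (x, y)) \<partial>PiM I (\<lambda>_. \<gamma>) \<partial>distr M borel X)"
    by (rule N.nn_integral_fst[symmetric]) measurable
  also have "\<dots> \<le> (\<integral>\<^sup>+x. c \<partial>distr M borel X)"
    using bound by (intro nn_integral_mono) simp
  also have "\<dots> = c"
    using \<mu>.emeasure_space_1 by simp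
  finally show ?thesis .
qed

section \<open>Error of one iteration and convergence\<close>

lemma borel_measurable_hj_prox_estimate:
  fixes z :: "nat \<Rightarrow> 'w \<Rightarrow> 'a::euclidean_space"
  assumes [measurable]: "F \<in> borel_measurable borel" "\<And>i. i \<in> {1..N} \<Longrightarrow> z i \<in> borel_measurable M"
  shows "(\<lambda>\<omega>. hj_prox_estimate F \<delta> N (\<lambda>i. z i \<omega>)) \<in> borel_measurable M"
  unfolding hj_prox_estimate_def by measurable

text \<open>The self-normalized bound is used with \<phi> the displacement from \<open>p\<close>, r
  = sqrt (\<delta> t), the spread constant D = 8/3 times 2 to the power n, and K equal to 5 to the
  power n times exp (2 \<Lambda>^2 t / \<delta>). Samples are written as \<open>x\<close> plus
  centred noise.\<close>

lemma hj_prox_estimate_error_fixed: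
  fixes F :: "real ^ 'n \<Rightarrow> real"
  assumes convex: "convex_on UNIV F" and lip: "\<Lambda>-lipschitz_on UNIV F"
    and t: "t > 0" and \<delta>: "\<delta> > 0" and N: "N > 0"
  shows "(\<integral>\<^sup>+y. ennreal (min 1 (norm (hj_prox_estimate F \<delta> N (\<lambda>i. x + y i) - prox F t x)))
        \<partial>PiM {1..N} (\<lambda>_. gaussian 0 (\<delta> * t)))
    \<le> ennreal (4 * (5 ^ CARD('n) * exp (2 / \<delta> * \<Lambda>\<^sup>2 * t)) / N + (1 / 2 + 8 / 3 * 2 ^ CARD('n)) * sqrt (\<delta> * t))"
proof -
  have F [measurable]: "F \<in> borel_measurable borel"
    using lip by (intro borel_measurable_continuous_onI lipschitz_on_continuous_on)
  interpret prob_space "gaussian (0 :: real ^ 'n) (\<delta> * t)"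
    using t \<delta> by (intro prob_space_gaussian) simp
  interpret G: prob_space "gaussian x (\<delta> * t)"
    using t \<delta> by (intro prob_space_gaussian) simp
  define p where "p = prox F t x"
  have sub: "F p + (x - p) \<bullet> (z - p) / t \<le> F z" for z
    unfolding p_def by (rule prox_subgradient[OF convex lip t])
  have xp: "norm (x - p) \<le> t * \<Lambda>"
    unfolding p_def by (rule norm_diff_prox_le[OF convex lip t])
  have shift: "(\<integral>\<^sup>+y. h (x + y) \<partial>gaussian 0 (\<delta> * t)) = (\<integral>\<^sup>+z. h z \<partial>gaussian x (\<delta> * t))"
    if [measurable]: "h \<in> borel_measurable borel" for h
    by (subst (2) gaussian_eq_translation) (simp add: nn_integral_distr)
  let ?w = "\<lambda>y. exp (- F (x + y) / \<delta>)" and ?\<phi> = "\<lambda>y. x + y - p"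
  let ?K = "5 ^ CARD('n) * exp (2 / \<delta> * \<Lambda>\<^sup>2 * t)"
  define m where "m = enn2real (\<integral>\<^sup>+z. ennreal (exp (- F z / \<delta>)) \<partial>gaussian x (\<delta> * t))"
  note second_moment = gaussian_weight_second_moment[of F p x t \<delta>, OF sub t \<delta> F]
  \<comment> \<open>Finiteness of the mean, needed for \<open>m\<close> to be faithful, comes from
    the second moment through a \<le> 1 + a^2.\<close>
  have "(\<integral>\<^sup>+z. ennreal (exp (- F z / \<delta>)) \<partial>gaussian x (\<delta> * t))
      \<le> (\<integral>\<^sup>+z. 1 + ennreal ((exp (- F z / \<delta>))\<^sup>2) \<partial>gaussian x (\<delta> * t))"
  proof (rule nn_integral_mono)
    fix z :: "real ^ 'n"
    have "a \<le> 1 + a\<^sup>2" if "a > 0" for a :: real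
      using zero_le_power2[of "a - 1"] that unfolding power2_diff by simp
    then have "exp (- F z / \<delta>) \<le> 1 + (exp (- F z / \<delta>))\<^sup>2"
      by simp
    then have "ennreal (exp (- F z / \<delta>)) \<le> ennreal (1 + (exp (- F z / \<delta>))\<^sup>2)"
      by (rule ennreal_leI)
    then show "ennreal (exp (- F z / \<delta>)) \<le> 1 + ennreal ((exp (- F z / \<delta>))\<^sup>2)"
      by (simp add: ennreal_plus)
  qed
  also have "\<dots> = 1 + (\<integral>\<^sup>+z. ennreal ((exp (- F z / \<delta>))\<^sup>2) \<partial>gaussian x (\<delta> * t))"
    using G.emeasure_space_1 by (subst nn_integral_add) auto
  also have "\<dots> \<le> 1 + ennreal ((exp (- F p / \<delta>))\<^sup>2)"
    by (intro add_left_mono second_moment)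
  also have "\<dots> < top"
    by simp
  finally have m: "(\<integral>\<^sup>+z. ennreal (exp (- F z / \<delta>)) \<partial>gaussian x (\<delta> * t)) = ennreal m"
    unfolding m_def by (intro ennreal_enn2real[symmetric])
  define a where "a = exp (- F p / \<delta> - \<Lambda>\<^sup>2 * t / \<delta>) / sqrt 5 ^ CARD('n)"
  have "ennreal a \<le> ennreal m"
    using gaussian_weight_mean_ge[OF lip xp t \<delta>] unfolding a_def m .
  moreover have a: "a > 0"
    by (simp add: a_def)
  ultimately have am: "a \<le> m"
    by (simp add: ennreal_le_iff2)
  \<comment> \<open>\<open>?K\<close> is chosen so that the lower bound \<open>a\<close> for the
    mean, squared, is scaled exactly to the upper bound for the second moment.\<close>
  have a2: "?K * a\<^sup>2 = (exp (- F p / \<delta>))\<^sup>2"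
  proof -
    have "(sqrt 5 ^ CARD('n))\<^sup>2 = (5::real) ^ CARD('n)"
      by (simp add: power_mult[symmetric] mult.commute[of _ 2] power_mult)
    then have "?K * a\<^sup>2 = exp (2 / \<delta> * \<Lambda>\<^sup>2 * t) * (exp (- F p / \<delta> - \<Lambda>\<^sup>2 * t / \<delta>))\<^sup>2"
      by (simp add: a_def power_divide)
    also have "\<dots> = exp (2 / \<delta> * \<Lambda>\<^sup>2 * t + 2 * (- F p / \<delta> - \<Lambda>\<^sup>2 * t / \<delta>))"
      by (simp only: exp_add exp_double)
    also have "2 / \<delta> * \<Lambda>\<^sup>2 * t + 2 * (- F p / \<delta> - \<Lambda>\<^sup>2 * t / \<delta>) = 2 * (- F p / \<delta>)"
      by (simp add: right_diff_distrib)
    finally show ?thesis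
      by (simp only: exp_double)
  qed
  have "(\<integral>\<^sup>+y. ennreal (min 1 (norm ((\<Sum>i\<in>{1..N}. ?w (y i) *\<^sub>R ?\<phi> (y i)) /\<^sub>R (\<Sum>i\<in>{1..N}. ?w (y i)))))
        \<partial>PiM {1..N} (\<lambda>_. gaussian 0 (\<delta> * t)))
    \<le> ennreal (4 * ?K / card {1..N} + (1 / 2 + 8 / 3 * 2 ^ CARD('n)) * sqrt (\<delta> * t))"
  proof (rule self_normalized_mean_error)
    show "(\<integral>\<^sup>+y. ennreal (?w y) \<partial>gaussian 0 (\<delta> * t)) = ennreal m"
      by (subst shift[of "\<lambda>z. ennreal (exp (- F z / \<delta>))"]) (simp, rule m)
    have "(\<integral>\<^sup>+y. ennreal ((?w y)\<^sup>2) \<partial>gaussian 0 (\<delta> * t)) \<le> ennreal (?K * a\<^sup>2)"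
      unfolding a2 by (subst shift[of "\<lambda>z. ennreal ((exp (- F z / \<delta>))\<^sup>2)"]) (simp, rule second_moment)
    also have "\<dots> \<le> ennreal (?K * m\<^sup>2)"
      using am a by (intro ennreal_leI mult_left_mono power_mono) auto
    finally show "(\<integral>\<^sup>+y. ennreal ((?w y)\<^sup>2) \<partial>gaussian 0 (\<delta> * t)) \<le> ennreal (?K * m\<^sup>2)" .
    have "(\<integral>\<^sup>+y. ennreal (?w y * (norm (?\<phi> y))\<^sup>2) \<partial>gaussian 0 (\<delta> * t))
        \<le> ennreal (8 / 3 * 2 ^ CARD('n) * (\<delta> * t)) * ennreal m"
      unfolding m[symmetric]
      by (subst shift[of "\<lambda>z. ennreal (exp (- F z / \<delta>) * (norm (z - p))\<^sup>2)"])
         (simp, rule gaussian_weight_spread[OF sub convex t \<delta> F])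
    then show "(\<integral>\<^sup>+y. ennreal (?w y * (norm (?\<phi> y))\<^sup>2) \<partial>gaussian 0 (\<delta> * t))
        \<le> ennreal (8 / 3 * 2 ^ CARD('n) * (sqrt (\<delta> * t))\<^sup>2 * m)"
      using t \<delta> am a by (simp add: ennreal_mult'[symmetric])
  qed (use N t \<delta> am a in auto)
  \<comment> \<open>The normalized weights sum to 1, so \<open>p\<close> can be subtracted inside
    the mean.\<close>
  moreover have "hj_prox_estimate F \<delta> N (\<lambda>i. x + y i) - p
      = (\<Sum>i\<in>{1..N}. ?w (y i) *\<^sub>R ?\<phi> (y i)) /\<^sub>R (\<Sum>i\<in>{1..N}. ?w (y i))" for y
  proof -
    have "(\<Sum>i\<in>{1..N}. ?w (y i)) > 0"
      using N by (intro sum_pos) auto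
    moreover have "(\<Sum>i\<in>{1..N}. ?w (y i) *\<^sub>R ?\<phi> (y i))
        = (\<Sum>i\<in>{1..N}. ?w (y i) *\<^sub>R (x + y i)) - (\<Sum>i\<in>{1..N}. ?w (y i)) *\<^sub>R p"
      by (simp add: scaleR_diff_right sum_subtractf scaleR_sum_left)
    ultimately show ?thesis
      by (simp add: hj_prox_estimate_def scaleR_diff_right)
  qed
  ultimately show ?thesis
    unfolding p_def by simp
qed

lemma hj_prox_estimate_error:
  fixes F :: "real ^ 'n \<Rightarrow> real" and X :: "'w \<Rightarrow> real ^ 'n" and Y :: "nat \<Rightarrow> 'w \<Rightarrow> real ^ 'n"
  assumes M: "prob_space M" "subalgebra M G" "X \<in> borel_measurable G" "\<And>i. i \<in> {1..N} \<Longrightarrow> Y i \<in> borel_measurable M"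
    and iid: "cond_iid M G {1..N} Y (\<lambda>\<omega>. gaussian (X \<omega>) (\<delta> * t))"
    and F: "convex_on UNIV F" "\<Lambda>-lipschitz_on UNIV F" "t > 0" "\<delta> > 0" "N > 0"
  shows "(\<integral>\<^sup>+\<omega>. ennreal (min 1 (norm (hj_prox_estimate F \<delta> N (\<lambda>i. Y i \<omega>) - prox F t (X \<omega>)))) \<partial>M)
    \<le> ennreal (4 * (5 ^ CARD('n) * exp (2 / \<delta> * \<Lambda>\<^sup>2 * t)) / N + (1 / 2 + 8 / 3 * 2 ^ CARD('n)) * sqrt (\<delta> * t))"
    (is "_ \<le> ?c")
proof -
  have [measurable]: "F \<in> borel_measurable borel"
    using F(2) by (intro borel_measurable_continuous_onI lipschitz_on_continuous_on)
  have [measurable]: "prox F t \<in> borel_measurable borel"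
    by (intro borel_measurable_continuous_onI continuous_on_prox[OF F(1-3)])
  \<comment> \<open>Coordinate 0 is free for the random argument because samples are numbered from
    1.\<close>
  define \<Phi> where "\<Phi> z = ennreal (min 1 (norm (hj_prox_estimate F \<delta> N z - prox F t (z 0))))" for z
  have hj_cong: "hj_prox_estimate F \<delta> N z = hj_prox_estimate F \<delta> N z'" if "\<And>i. i \<in> {1..N} \<Longrightarrow> z i = z' i" for z z'
    using that by (simp add: hj_prox_estimate_def)
  have "(\<integral>\<^sup>+\<omega>. \<Phi> (\<lambda>i\<in>insert 0 {1..N}. if i = 0 then X \<omega> else Y i \<omega>) \<partial>M) \<le> ?c"
  proof (rule cond_iid_nn_integral_le[OF M])
    show "prob_space (gaussian (0 :: real ^ 'n) (\<delta> * t))"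
      using F by (intro prob_space_gaussian) simp
    show "cond_iid M G {1..N} Y (\<lambda>\<omega>. distr (gaussian 0 (\<delta> * t)) borel (\<lambda>y. X \<omega> + y))"
      using iid by (simp add: gaussian_eq_translation[symmetric])
    have "(\<lambda>z. hj_prox_estimate F \<delta> N (\<lambda>i. z i)) \<in> borel_measurable (PiM (insert 0 {1..N}) (\<lambda>_. borel))"
      by (intro borel_measurable_hj_prox_estimate) auto
    then have [measurable]: "hj_prox_estimate F \<delta> N \<in> borel_measurable (PiM (insert 0 {1..N}) (\<lambda>_. borel))"
      by simp
    show "\<Phi> \<in> borel_measurable (PiM (insert 0 {1..N}) (\<lambda>_. borel))"
      unfolding \<Phi>_def by measurable
    fix x :: "real ^ 'n"
    have "hj_prox_estimate F \<delta> N (\<lambda>i\<in>insert 0 {1..N}. if i = 0 then x else x + y i)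
        = hj_prox_estimate F \<delta> N (\<lambda>i. x + y i)" for y
      by (rule hj_cong) auto
    then show "(\<integral>\<^sup>+y. \<Phi> (\<lambda>i\<in>insert 0 {1..N}. if i = 0 then x else x + y i) \<partial>PiM {1..N} (\<lambda>_. gaussian 0 (\<delta> * t))) \<le> ?c"
      using hj_prox_estimate_error_fixed[OF F, of x] by (simp add: \<Phi>_def)
  qed auto
  moreover have "hj_prox_estimate F \<delta> N (\<lambda>i\<in>insert 0 {1..N}. if i = 0 then X \<omega> else Y i \<omega>)
      = hj_prox_estimate F \<delta> N (\<lambda>i. Y i \<omega>)" for \<omega>
    by (rule hj_cong) auto
  ultimately show ?thesis
    by (simp add: \<Phi>_def)
qed

section \<open>The sample history, truncated summability and almost sure convergence\<close>

lemma subalgebra_sample_history: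
  assumes "\<And>j i. j \<ge> 1 \<Longrightarrow> i \<in> {1..N j} \<Longrightarrow> Z j i \<in> borel_measurable M"
  shows "subalgebra M (sample_history M N Z k)"
proof -
  have "(\<Union>j\<in>{1..<k}. \<Union>i\<in>{1..N j}. {Z j i -` A \<inter> space M |A. A \<in> sets borel}) \<subseteq> sets M"
    using assms by (auto intro!: measurable_sets)
  then show ?thesis
    unfolding subalgebra_def sample_history_def
    by (auto simp: sets.sigma_sets_subset space_measure_of_conv sets_measure_of_conv split: if_splits)
qed

lemma measurable_sample_history:
  assumes "1 \<le> j" "j < k" "i \<in> {1..N j}"
  shows "Z j i \<in> borel_measurable (sample_history M N Z k)"
proof (rule measurableI)
  let ?E = "\<Union>j\<in>{1..<k}. \<Union>i\<in>{1..N j}. {Z j i -` A \<inter> space M |A. A \<in> sets borel}"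
  have E: "?E \<subseteq> Pow (space M)"
    by auto
  fix A :: "'b set" assume "A \<in> sets borel"
  with assms have "Z j i -` A \<inter> space M \<in> ?E"
    by fastforce
  then show "Z j i -` A \<inter> space (sample_history M N Z k) \<in> sets (sample_history M N Z k)"
    using E unfolding sample_history_def by (simp add: sets_measure_of space_measure_of)
qed simp

text \<open>Summable terms tend to 0, so the truncation at 1 is eventually inactive.\<close>

lemma summable_if_summable_min:
  fixes e :: "nat \<Rightarrow> real"
  assumes "summable (\<lambda>k. min 1 (e k))"
  shows "summable e"
proof -
  have "\<forall>\<^sub>F k in sequentially. min 1 (e k) < 1"
    using summable_LIMSEQ_zero[OF assms] by (rule order_tendstoD) simp
  then have "\<forall>\<^sub>F k in sequentially. min 1 (e k) = e k"
    by eventually_elim (auto simp: min_def)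
  then show ?thesis
    using assms summable_cong[of "\<lambda>k. min 1 (e k)" e] by simp
qed

text \<open>A bound O(1/k) alone would admit summable steps such as 1/k^2, with which the iterates
  can stop short of a minimizer; the rate is therefore read together with divergence of the sum of
  the steps.\<close>

theorem theorem3p5:
  fixes f g :: "real ^ 'n \<Rightarrow> real"
    and L \<Lambda> :: real
    and t \<delta> \<alpha> J V :: "nat \<Rightarrow> real"
    and N :: "nat \<Rightarrow> nat"
    and x1 :: "real ^ 'n"
    and M :: "'w measure"
    and Z :: "nat \<Rightarrow> nat \<Rightarrow> 'w \<Rightarrow> real ^ 'n"
    and X :: "nat \<Rightarrow> 'w \<Rightarrow> real ^ 'n"
  assumes f: "lower_semicontinuous f" "convex_on UNIV f" "L-lipschitz_on UNIV f"
    and g: "lower_semicontinuous g" "convex_on UNIV g" "L-lipschitz_on UNIV g"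
    and argmin_nonempty: "\<exists>z. is_arg_min (\<lambda>x. f x + g x) (\<lambda>_. True) z"
    and sum_lipschitz: "\<Lambda>-lipschitz_on UNIV (\<lambda>x. f x + g x)"
    and t_pos: "\<And>k. k \<ge> 1 \<Longrightarrow> t k > 0"
    and t_rate: "t \<longlonglongrightarrow> 0" "t \<in> O(\<lambda>k. 1 / real k)" "\<not> summable (\<lambda>k. t (Suc k))"
    and \<delta>_pos: "\<And>k. k \<ge> 1 \<Longrightarrow> \<delta> k > 0"
    and \<alpha>_range: "\<And>k. k \<ge> 1 \<Longrightarrow> \<alpha> k \<in> {0<..<1}"
    and \<delta>_summable: "summable (\<lambda>k. \<delta> (Suc k))"
    and \<alpha>_summable: "summable (\<lambda>k. \<alpha> (Suc k))"
    and N_pos: "\<And>k. k \<ge> 1 \<Longrightarrow> N k > 0"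
    and J: "\<And>k. k \<ge> 1 \<Longrightarrow> J k = exp (2 / \<delta> k * \<Lambda>\<^sup>2 * t k)"
    and V: "\<And>k. k \<ge> 1 \<Longrightarrow> V k = CARD('n) * t k * \<delta> k
                       + (2 * sqrt (CARD('n) * t k * \<delta> k) + 3 * \<Lambda> * t k)\<^sup>2"
    and N_ge: "\<And>k. k \<ge> 1 \<Longrightarrow> real (N k) \<ge> 8 * J k / \<alpha> k"
    and error_summable: "summable (\<lambda>k. sqrt (8 * J (Suc k) * V (Suc k) / (\<alpha> (Suc k) * N (Suc k)))
                                      + sqrt (CARD('n) * t (Suc k) * \<delta> (Suc k)))"
    and M: "prob_space M"
    and Z_measurable: "\<And>k i. k \<ge> 1 \<Longrightarrow> i \<in> {1..N k} \<Longrightarrow> Z k i \<in> borel_measurable M"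
    and Z_law: "\<And>k. k \<ge> 1 \<Longrightarrow>
           cond_iid M (sample_history M N Z k) {1..N k} (Z k) (\<lambda>\<omega>. gaussian (X k \<omega>) (\<delta> k * t k))"
    and X_init: "\<And>\<omega>. \<omega> \<in> space M \<Longrightarrow> X 1 \<omega> = x1"
    and X_step: "\<And>k \<omega>. k \<ge> 1 \<Longrightarrow> \<omega> \<in> space M \<Longrightarrow>
           X (Suc k) \<omega> = hj_prox_estimate (\<lambda>x. f x + g x) (\<delta> k) (N k) (\<lambda>i. Z k i \<omega>)"
  shows "AE \<omega> in M. \<exists>z. is_arg_min (\<lambda>x. f x + g x) (\<lambda>_. True) z \<and> (\<lambda>k. X k \<omega>) \<longlonglongrightarrow> z"
proof -
  interpret prob_space M by (rule M)
  define F where "F x = f x + g x" for x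
  define G where "G k = sample_history M N Z k" for k
  have convex: "convex_on UNIV F"
    unfolding F_def using f(2) g(2) by (rule convex_on_add)
  have lip: "\<Lambda>-lipschitz_on UNIV F"
    unfolding F_def by (rule sum_lipschitz)
  have [measurable]: "F \<in> borel_measurable borel"
    using lip by (intro borel_measurable_continuous_onI lipschitz_on_continuous_on)
  have G: "subalgebra M (G k)" for k
    unfolding G_def using Z_measurable by (rule subalgebra_sample_history)
  then have space_G: "space (G k) = space M" for k
    by (simp add: subalgebra_def)
  \<comment> \<open>The iterate is computed from the samples of iteration \<open>k\<close>, the last
    ones in the history before \<open>Suc k\<close>; for \<open>k = 0\<close> it is the constant
    \<open>x1\<close>.\<close>
  have X_G: "X (Suc k) \<in> borel_measurable (G (Suc k))" for k
  proof (cases k)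
    case 0
    have "X 1 \<in> borel_measurable (G 1) \<longleftrightarrow> (\<lambda>_. x1) \<in> borel_measurable (G 1)"
      by (rule measurable_cong) (use X_init in \<open>simp add: space_G\<close>)
    with 0 show ?thesis
      by simp
  next
    case (Suc j)
    have "X (Suc k) \<in> borel_measurable (G (Suc k)) \<longleftrightarrow>
        (\<lambda>\<omega>. hj_prox_estimate F (\<delta> k) (N k) (\<lambda>i. Z k i \<omega>)) \<in> borel_measurable (G (Suc k))"
      by (rule measurable_cong) (use Suc in \<open>simp add: space_G X_step F_def[abs_def]\<close>)
    moreover have "(\<lambda>\<omega>. hj_prox_estimate F (\<delta> k) (N k) (\<lambda>i. Z k i \<omega>)) \<in> borel_measurable (G (Suc k))"
      unfolding G_def using Suc by (intro borel_measurable_hj_prox_estimate measurable_sample_history) auto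
    ultimately show ?thesis
      by simp
  qed
  have X_M [measurable]: "X (Suc k) \<in> borel_measurable M" for k
    using measurable_from_subalg[OF G X_G] .
  define p where "p k \<omega> = prox F (t (Suc k)) (X (Suc k) \<omega>)" for k \<omega>
  have prox_M: "prox F (t (Suc k)) \<in> borel_measurable borel" for k
    using continuous_on_prox[OF convex lip t_pos] by (intro borel_measurable_continuous_onI) simp
  have p_M [measurable]: "p k \<in> borel_measurable M" for k
    unfolding p_def[abs_def] using measurable_compose[OF X_M prox_M] .
  define e where "e k \<omega> = norm (X (Suc (Suc k)) \<omega> - p k \<omega>)" for k \<omega>
  have e_M [measurable]: "e k \<in> borel_measurable M" for k
    unfolding e_def[abs_def] by measurable
  define D where "D = 1 / 2 + 8 / 3 * (2 :: real) ^ CARD('n)"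
  \<comment> \<open>The \<alpha> term covers the fluctuation part by \<open>N_ge\<close>, as 4 J / N
    \<le> \<alpha> / 2. The bracket is the summand of \<open>error_summable\<close> and dominates
    sqrt (\<delta> t), the dimension being at least 1.\<close>
  define c where "c k = 5 ^ CARD('n) / 2 * \<alpha> (Suc k) + D * (sqrt (8 * J (Suc k) * V (Suc k) / (\<alpha> (Suc k) * N (Suc k)))
      + sqrt (CARD('n) * t (Suc k) * \<delta> (Suc k)))" for k
  have c_sum: "summable c"
    unfolding c_def by (intro summable_add summable_mult \<alpha>_summable error_summable)
  have c0: "c k \<ge> 0" and e_le: "(\<integral>\<^sup>+\<omega>. ennreal (min 1 (e k \<omega>)) \<partial>M) \<le> ennreal (c k)" for k
  proof -
    define j where "j = Suc k"
    have j: "j \<ge> 1"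
      by (simp add: j_def)
    note pos = t_pos[OF j] \<delta>_pos[OF j] N_pos[OF j] \<alpha>_range[OF j]
    have "4 * (5 ^ CARD('n) * exp (2 / \<delta> j * \<Lambda>\<^sup>2 * t j)) / N j \<le> 5 ^ CARD('n) / 2 * \<alpha> j"
    proof -
      have "8 * J j \<le> real (N j) * \<alpha> j"
        using N_ge[OF j] pos by (simp add: pos_divide_le_eq)
      then have "4 * J j / N j \<le> \<alpha> j / 2"
        using pos by (simp add: field_simps)
      then have "5 ^ CARD('n) * (4 * J j / N j) \<le> 5 ^ CARD('n) * (\<alpha> j / 2)"
        by (intro mult_left_mono) auto
      then show ?thesis
        unfolding J[OF j] by (simp add: mult_ac)
    qed
    moreover have "D * sqrt (\<delta> j * t j)
        \<le> D * (sqrt (8 * J j * V j / (\<alpha> j * N j)) + sqrt (CARD('n) * t j * \<delta> j))"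
    proof (intro mult_left_mono)
      have "1 * (t j * \<delta> j) \<le> real CARD('n) * (t j * \<delta> j)"
        using pos by (intro mult_right_mono) (auto simp: Suc_le_eq)
      then have "sqrt (\<delta> j * t j) \<le> sqrt (CARD('n) * t j * \<delta> j)"
        by (simp add: mult_ac)
      moreover have "0 \<le> V j"
        unfolding V[OF j] using pos by simp
      then have "0 \<le> sqrt (8 * J j * V j / (\<alpha> j * N j))"
        using pos by (simp add: J[OF j])
      ultimately show "sqrt (\<delta> j * t j) \<le> sqrt (8 * J j * V j / (\<alpha> j * N j)) + sqrt (CARD('n) * t j * \<delta> j)"
        by linarith
    qed (simp add: D_def)
    ultimately have le_c: "4 * (5 ^ CARD('n) * exp (2 / \<delta> j * \<Lambda>\<^sup>2 * t j)) / N j + D * sqrt (\<delta> j * t j) \<le> c k"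
      unfolding c_def j_def by linarith
    have "0 \<le> 4 * (5 ^ CARD('n) * exp (2 / \<delta> j * \<Lambda>\<^sup>2 * t j)) / N j + D * sqrt (\<delta> j * t j)"
      using pos by (simp add: D_def)
    with le_c show "c k \<ge> 0"
      by linarith
    have "(\<integral>\<^sup>+\<omega>. ennreal (min 1 (e k \<omega>)) \<partial>M)
        = (\<integral>\<^sup>+\<omega>. ennreal (min 1 (norm (hj_prox_estimate F (\<delta> j) (N j) (\<lambda>i. Z j i \<omega>) - prox F (t j) (X j \<omega>)))) \<partial>M)"
      by (intro nn_integral_cong) (simp add: e_def p_def j_def X_step F_def[abs_def])
    also have "\<dots> \<le> ennreal (4 * (5 ^ CARD('n) * exp (2 / \<delta> j * \<Lambda>\<^sup>2 * t j)) / N j + D * sqrt (\<delta> j * t j))"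
      unfolding D_def
      using Z_law[OF j] Z_measurable[OF j] pos X_G[of k] convex lip
      by (intro hj_prox_estimate_error[OF M G]) (auto simp: G_def j_def)
    also have "\<dots> \<le> ennreal (c k)"
      by (rule ennreal_leI[OF le_c])
    finally show "(\<integral>\<^sup>+\<omega>. ennreal (min 1 (e k \<omega>)) \<partial>M) \<le> ennreal (c k)" .
  qed
  \<comment> \<open>By Tonelli the truncated errors have a finite expected sum, so they are almost
    surely summable.\<close>
  have "(\<integral>\<^sup>+\<omega>. (\<Sum>k. ennreal (min 1 (e k \<omega>))) \<partial>M) = (\<Sum>k. \<integral>\<^sup>+\<omega>. ennreal (min 1 (e k \<omega>)) \<partial>M)"
    by (rule nn_integral_suminf) measurable
  also have "\<dots> \<le> (\<Sum>k. ennreal (c k))"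
    by (intro suminf_le e_le) auto
  also have "\<dots> = ennreal (suminf c)"
    by (rule suminf_ennreal2[OF c0 c_sum])
  also have "\<dots> < \<infinity>"
    by simp
  finally have "AE \<omega> in M. (\<Sum>k. ennreal (min 1 (e k \<omega>))) \<noteq> \<infinity>"
    by (intro nn_integral_noteq_infinite) auto
  then have "AE \<omega> in M. summable (\<lambda>k. e k \<omega>)"
  proof (rule eventually_mono)
    fix \<omega> assume "(\<Sum>k. ennreal (min 1 (e k \<omega>))) \<noteq> \<infinity>"
    then have "summable (\<lambda>k. min 1 (e k \<omega>))"
      by (intro summable_suminf_not_top) (auto simp: e_def)
    then show "summable (\<lambda>k. e k \<omega>)"
      by (rule summable_if_summable_min)
  qed
  then show ?thesis
  proof (rule eventually_mono)
    fix \<omega> assume err: "summable (\<lambda>k. e k \<omega>)"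
    obtain z0 where z0: "\<And>y. F z0 \<le> F y"
      using argmin_nonempty unfolding is_arg_min_def F_def by (auto simp: not_less)
    \<comment> \<open>From here the argument is deterministic, path by path, on the sequence shifted
      to start at index 0.\<close>
    have "\<exists>z. (\<forall>y. F z \<le> F y) \<and> (\<lambda>k. X (Suc k) \<omega>) \<longlonglongrightarrow> z"
    proof (rule inexact_proximal_point_converges[OF lip])
      show "F (p k \<omega>) + (X (Suc k) \<omega> - p k \<omega>) \<bullet> (z - p k \<omega>) / t (Suc k) \<le> F z" for k z
        unfolding p_def by (rule prox_subgradient[OF convex lip t_pos]) simp
    qed (use err t_pos t_rate(3) z0 in \<open>auto simp: e_def\<close>)
    then show "\<exists>z. is_arg_min (\<lambda>x. f x + g x) (\<lambda>_. True) z \<and> (\<lambda>k. X k \<omega>) \<longlonglongrightarrow> z"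
      by (auto simp: is_arg_min_def F_def not_less dest!: LIMSEQ_imp_Suc)
  qed
qed

end
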